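(* If $G$ is a $\Delta^1_1$ graph on $\mathcal{N}$ that is generated by a countable list of Borel functions $\mathcal{N}\to\mathcal{N}$, then $G$ is generated by a countable list of $\Delta^1_1$ functions $\mathcal{N}\to\mathcal{N}$.
   Context: $\mathcal{N}=\omega^\omega$ and $\Delta^1_1$ is the lightface pointclass. A graph on $X$ is a symmetric irreflexive subset of $X^2$. A graph $G$ is generated by a list of functions $\langle f_i:i\in I\rangle$ if $G\subseteq\{(x,y):y=f_i(x)\text{ or }x=f_i(y)\text{ for some }i\in I\}$. *)

theory Defs
  imports "HOL-Analysis.Analysis" "HOL-Library.Nat_Bijection"
begin

section \<open>Recursive functions on the natural numbers\<close>

text \<open>
  The total recursive functions: the least class containing the constants zero, successor and
  projections and closed under composition, primitive recursion and minimalization of regular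
  functions. In \<open>recfn k f\<close> the number \<open>k\<close> is the arity, and only the values of \<open>f\<close> on lists
  of length \<open>k\<close> are meaningful.
\<close>

inductive recfn :: "nat \<Rightarrow> (nat list \<Rightarrow> nat) \<Rightarrow> bool" where
  zero: "recfn k (\<lambda>_. 0)"
| succ: "recfn 1 (\<lambda>xs. Suc (hd xs))"
| proj: "i < k \<Longrightarrow> recfn k (\<lambda>xs. xs ! i)"
| comp: "recfn m f \<Longrightarrow> length gs = m \<Longrightarrow> (\<forall>g\<in>set gs. recfn k g) \<Longrightarrow>
           recfn k (\<lambda>xs. f (map (\<lambda>g. g xs) gs))"
| prec: "recfn k f \<Longrightarrow> recfn (k + 2) g \<Longrightarrow>
           recfn (k + 1) (\<lambda>xs. rec_nat (f (tl xs)) (\<lambda>n r. g (n # r # tl xs)) (hd xs))"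
| minimize: "recfn (k + 1) f \<Longrightarrow> (\<forall>xs. length xs = k \<longrightarrow> (\<exists>n. f (n # xs) = 0)) \<Longrightarrow>
           recfn k (\<lambda>xs. LEAST n. f (n # xs) = 0)"

definition rec_enumerable :: "nat set \<Rightarrow> bool" where
  "rec_enumerable W \<longleftrightarrow> (\<exists>f. recfn 2 f \<and> W = {n. \<exists>m. f [m, n] = 0})"

section \<open>Lightface pointclasses\<close>

type_synonym baire = "nat \<Rightarrow> nat"

text \<open>
  A space enters through a numbering \<open>B\<close> of a basis of its topology. On the Baire space the basic
  neighbourhoods are the sets of all extensions of a finite sequence, numbered by the (primitive
  recursive) coding \<^const>\<open>list_encode\<close>; on products they are the boxes.
\<close>

definition baire_basis :: "nat \<Rightarrow> baire set" where
  "baire_basis c = {x. \<forall>i < length (list_decode c). x i = list_decode c ! i}"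

definition prod_basis :: "(nat \<Rightarrow> 'a set) \<Rightarrow> (nat \<Rightarrow> 'b set) \<Rightarrow> nat \<Rightarrow> ('a \<times> 'b) set" where
  "prod_basis B C c = B (fst (prod_decode c)) \<times> C (snd (prod_decode c))"

definition sigma01 :: "(nat \<Rightarrow> 'a set) \<Rightarrow> 'a set \<Rightarrow> bool" where
  "sigma01 B A \<longleftrightarrow> (\<exists>W. rec_enumerable W \<and> A = (\<Union>c\<in>W. B c))"

definition pi01 :: "(nat \<Rightarrow> 'a set) \<Rightarrow> 'a set \<Rightarrow> bool" where
  "pi01 B A \<longleftrightarrow> sigma01 B (- A)"

definition sigma11 :: "(nat \<Rightarrow> 'a set) \<Rightarrow> 'a set \<Rightarrow> bool" where
  "sigma11 B A \<longleftrightarrow> (\<exists>F. pi01 (prod_basis B baire_basis) F \<and> A = {x. \<exists>z. (x, z) \<in> F})"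

definition pi11 :: "(nat \<Rightarrow> 'a set) \<Rightarrow> 'a set \<Rightarrow> bool" where
  "pi11 B A \<longleftrightarrow> sigma11 B (- A)"

definition delta11 :: "(nat \<Rightarrow> 'a set) \<Rightarrow> 'a set \<Rightarrow> bool" where
  "delta11 B A \<longleftrightarrow> sigma11 B A \<and> pi11 B A"

abbreviation delta11_rel :: "(baire \<times> baire) set \<Rightarrow> bool" where
  "delta11_rel \<equiv> delta11 (prod_basis baire_basis baire_basis)"

definition delta11_fun :: "(baire \<Rightarrow> baire) \<Rightarrow> bool" where
  "delta11_fun f \<longleftrightarrow> delta11_rel {(x, y). y = f x}"

section \<open>Graphs generated by functions\<close>

definition is_graph :: "('a \<times> 'a) set \<Rightarrow> bool" where
  "is_graph G \<longleftrightarrow> sym G \<and> irrefl G"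

text \<open>Only an inclusion is required, not equality.\<close>

definition generated_by :: "('a \<times> 'a) set \<Rightarrow> 'i set \<Rightarrow> ('i \<Rightarrow> 'a \<Rightarrow> 'a) \<Rightarrow> bool" where
  "generated_by G I f \<longleftrightarrow> G \<subseteq> {(x, y). \<exists>i\<in>I. y = f i x \<or> x = f i y}"

end

theory Submission
  imports Defs
begin

text \<open>
  Coding Delta11 functions by numbers, by means of a uniform version of the separation theorem for
  Sigma11 sets, yields a Pi11 set \<open>U\<close> that is covered by the Delta11 functions and contains every
  Sigma11 partial function. Hence the set \<open>H\<close> of all pairs in \<open>G\<close> that belong neither to \<open>U\<close> nor to
  its inverse is Sigma11, and it suffices to show that it is empty.
  Suppose that \<open>H\<close> is not empty. It is covered by countably many graphs of Borel functions and
  their inverses, so by the Baire category theorem for the Gandy-Harrington topology one of them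
  is comeager in a nonempty Sigma11 set \<open>Q \<subseteq> H\<close>, say the graph of \<open>f\<close>. Then \<open>Q\<close> is a partial function:
  otherwise the triples \<open>(x, y, y')\<close> with \<open>(x, y), (x, y') \<in> Q\<close> and \<open>y \<noteq> y'\<close> form a nonempty Sigma11
  set, and a generic element of it satisfies \<open>y = f x = y'\<close>. So \<open>Q\<close> is
  contained in \<open>U\<close>, which contradicts \<open>Q \<subseteq> H\<close>.
\<close>

text \<open>The obstacle is definability: the graphs of all Delta11 functions must be removed from
  \<open>G\<close> at once, and the rest must still be Sigma11, since this makes it open in the
  Gandy-Harrington topology. The codes of functional sets form only a Pi11 set, so separation has to
  be uniform in the code and may fail at the other codes. Comparison of trees supplies this: that
  the first tree embeds into the second, in the sense of a simulation, is a Sigma11 statement at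
  every parameter, and its negation is Sigma11 wherever at most one of the trees has an infinite
  branch. The Borel functions carry no effective code. They enter only through the property of
  Baire, which their graphs have because the Gandy-Harrington topology refines the usual one.
  Finally, the two pairs inside a generic triple need not be generic independently of each other. It
  is enough that each of them is generic in \<open>Q\<close>, and this holds because computable maps
  send Sigma11 sets to Sigma11 sets.\<close>

section \<open>Recursive functions up to equality on lists of the right length\<close>

text \<open>The values of a \<open>recfn\<close> function on lists of the wrong length are artifacts
  of its construction. Ignoring them allows pointwise rewriting.\<close>

definition recl :: "nat \<Rightarrow> (nat list \<Rightarrow> nat) \<Rightarrow> bool" where
  "recl k f \<longleftrightarrow> (\<exists>g. recfn k g \<and> (\<forall>xs. length xs = k \<longrightarrow> f xs = g xs))"

definition rec1 :: "(nat \<Rightarrow> nat) \<Rightarrow> bool" where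
  "rec1 h \<longleftrightarrow> recl 1 (\<lambda>xs. h (xs ! 0))"

definition rec2 :: "(nat \<Rightarrow> nat \<Rightarrow> nat) \<Rightarrow> bool" where
  "rec2 h \<longleftrightarrow> recl 2 (\<lambda>xs. h (xs ! 0) (xs ! 1))"

definition rec3 :: "(nat \<Rightarrow> nat \<Rightarrow> nat \<Rightarrow> nat) \<Rightarrow> bool" where
  "rec3 h \<longleftrightarrow> recl 3 (\<lambda>xs. h (xs ! 0) (xs ! 1) (xs ! 2))"

lemma recl_cong: "recl k f \<Longrightarrow> (\<And>xs. length xs = k \<Longrightarrow> f xs = g xs) \<Longrightarrow> recl k g"
  unfolding recl_def by metis

lemma recl_recfn: "recfn k f \<Longrightarrow> recl k f"
  unfolding recl_def by blast

lemma recl_proj: "i < k \<Longrightarrow> recl k (\<lambda>xs. xs ! i)"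
  by (intro recl_recfn recfn.proj)

lemma recl_comp:
  assumes "recl m f" "length gs = m" "\<forall>g\<in>set gs. recl k g"
  shows "recl k (\<lambda>xs. f (map (\<lambda>g. g xs) gs))"
proof -
  obtain f' where f': "recfn m f'" "\<And>xs. length xs = m \<Longrightarrow> f xs = f' xs"
    using assms(1) unfolding recl_def by blast
  obtain c where c: "\<And>g. g \<in> set gs \<Longrightarrow> recfn k (c g)"
    "\<And>g xs. g \<in> set gs \<Longrightarrow> length xs = k \<Longrightarrow> g xs = c g xs"
    using assms(3) unfolding recl_def by metis
  have "recfn k (\<lambda>xs. f' (map (\<lambda>g. g xs) (map c gs)))"
    using f'(1) assms(2) c(1) by (intro recfn.comp) auto
  moreover have "f (map (\<lambda>g. g xs) gs) = f' (map (\<lambda>g. g xs) (map c gs))" if "length xs = k" for xs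
    using f'(2)[of "map (\<lambda>g. g xs) gs"] assms(2) c(2) that
    by (auto simp: comp_def cong: map_cong)
  ultimately show ?thesis unfolding recl_def by blast
qed

lemma recl_comp1: "rec1 h \<Longrightarrow> recl k f \<Longrightarrow> recl k (\<lambda>xs. h (f xs))"
  using recl_comp[of 1 "\<lambda>xs. h (xs ! 0)" "[f]" k] by (simp add: rec1_def)

lemma recl_comp2: "rec2 h \<Longrightarrow> recl k f \<Longrightarrow> recl k g \<Longrightarrow> recl k (\<lambda>xs. h (f xs) (g xs))"
  using recl_comp[of 2 "\<lambda>xs. h (xs ! 0) (xs ! 1)" "[f, g]" k] by (simp add: rec2_def)

lemma recl_comp3: "rec3 h \<Longrightarrow> recl k f \<Longrightarrow> recl k g \<Longrightarrow> recl k j \<Longrightarrow> recl k (\<lambda>xs. h (f xs) (g xs) (j xs))"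
  using recl_comp[of 3 "\<lambda>xs. h (xs ! 0) (xs ! 1) (xs ! 2)" "[f, g, j]" k] by (simp add: rec3_def)

lemma rec1_Suc: "rec1 Suc"
  unfolding rec1_def
proof (rule recl_cong[OF recl_recfn[OF recfn.succ]])
  show "Suc (hd xs) = Suc (xs ! 0)" if "length xs = 1" for xs :: "nat list"
    using that by (cases xs) auto
qed

lemma recl_const: "recl k (\<lambda>_. c)"
proof (induction c)
  case 0
  show ?case by (intro recl_recfn recfn.zero)
next
  case (Suc c)
  from recl_comp1[OF rec1_Suc Suc] show ?case .
qed

text \<open>The generator \<open>prec\<close> recurses on the head of the list. Composition with
  \<open>n\<close> and all \<open>k\<close> projections gives recursion up to a computed bound with
  the whole list as parameter.\<close>

lemma recl_rec:
  assumes a: "recl k a" and g: "recl (k + 2) (\<lambda>ys. g (ys ! 0) (ys ! 1) (drop 2 ys))" and n: "recl k n"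
  shows "recl k (\<lambda>xs. rec_nat (a xs) (\<lambda>m r. g m r xs) (n xs))"
proof -
  obtain a' where a': "recfn k a'" "\<And>xs. length xs = k \<Longrightarrow> a xs = a' xs"
    using a unfolding recl_def by blast
  obtain g' where g': "recfn (k + 2) g'"
    "\<And>xs. length xs = k + 2 \<Longrightarrow> g (xs ! 0) (xs ! 1) (drop 2 xs) = g' xs"
    using g unfolding recl_def by blast
  have "recl (k + 1) (\<lambda>xs. rec_nat (a' (tl xs)) (\<lambda>n r. g' (n # r # tl xs)) (hd xs))" (is "recl _ ?F")
    by (intro recl_recfn recfn.prec a' g')
  then have "recl k (\<lambda>xs. ?F (map (\<lambda>g. g xs) (n # map (\<lambda>i xs. xs ! i) [0..<k])))"
    using n by (intro recl_comp) (auto intro: recl_proj)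
  then show ?thesis
  proof (rule recl_cong)
    fix xs :: "nat list" assume xs: "length xs = k"
    have "map (\<lambda>g. g xs) (n # map (\<lambda>i xs. xs ! i) [0..<k]) = n xs # xs"
      using xs by (auto simp: comp_def map_nth)
    moreover have "g' (m # r # xs) = g m r xs" for m r
      using g'(2)[of "m # r # xs"] xs by simp
    ultimately show "?F (map (\<lambda>g. g xs) (n # map (\<lambda>i xs. xs ! i) [0..<k])) =
        rec_nat (a xs) (\<lambda>m r. g m r xs) (n xs)"
      using a'(2) xs by simp
  qed
qed

lemma recl_Least:
  assumes f: "recl (k + 1) (\<lambda>ys. f (ys ! 0) (tl ys))"
    and ex: "\<And>xs. length xs = k \<Longrightarrow> \<exists>n. f n xs = 0"
  shows "recl k (\<lambda>xs. LEAST n. f n xs = 0)"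
proof -
  obtain f' where f': "recfn (k + 1) f'" "\<And>xs. length xs = k + 1 \<Longrightarrow> f (xs ! 0) (tl xs) = f' xs"
    using f unfolding recl_def by blast
  have eq: "f' (n # xs) = f n xs" if "length xs = k" for n xs
    using f'(2)[of "n # xs"] that by simp
  have "recl k (\<lambda>xs. LEAST n. f' (n # xs) = 0)"
    using f'(1) ex eq by (intro recl_recfn recfn.minimize) auto
  then show ?thesis by (rule recl_cong) (simp add: eq)
qed

lemma rec1I: "recl 1 (\<lambda>xs. h (xs ! 0)) \<Longrightarrow> rec1 h"
  by (simp add: rec1_def)
lemma rec2I: "recl 2 (\<lambda>xs. h (xs ! 0) (xs ! 1)) \<Longrightarrow> rec2 h"
  by (simp add: rec2_def)
lemma rec3I: "recl 3 (\<lambda>xs. h (xs ! 0) (xs ! 1) (xs ! 2)) \<Longrightarrow> rec3 h"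
  by (simp add: rec3_def)

section \<open>Recursive arithmetic and recursive relations\<close>

named_theorems rec_intros
lemmas [rec_intros] = recl_const recl_comp1[OF rec1_Suc]

lemma recl_proj0 [rec_intros]: "0 < k \<Longrightarrow> recl k (\<lambda>xs. xs ! 0)"
  and recl_proj1 [rec_intros]: "1 < k \<Longrightarrow> recl k (\<lambda>xs. xs ! 1)"
  and recl_proj2 [rec_intros]: "2 < k \<Longrightarrow> recl k (\<lambda>xs. xs ! 2)"
  by (simp_all add: recl_proj)

lemma rec1_prec:
  assumes "rec2 g" shows "rec1 (\<lambda>n. rec_nat a g n)"
proof -
  have "recl 1 (\<lambda>xs. rec_nat a (\<lambda>m r. g m r) (xs ! 0))"
  proof (rule recl_rec[where g = "\<lambda>m r xs. g m r" and a = "\<lambda>_. a" and n = "\<lambda>xs. xs ! 0"])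
    show "recl (1 + 2) (\<lambda>ys. g (ys ! 0) (ys ! 1))"
      by (intro recl_comp2[OF assms] recl_proj) auto
  qed (simp_all add: recl_const recl_proj)
  then show ?thesis by (simp add: rec1_def)
qed

lemma rec2_prec:
  assumes "rec1 a" "rec3 g" shows "rec2 (\<lambda>x n. rec_nat (a x) (\<lambda>m r. g m r x) n)"
  unfolding rec2_def
proof (rule recl_rec[where g = "\<lambda>m r xs. g m r (xs ! 0)" and a = "\<lambda>xs. a (xs ! 0)" and n = "\<lambda>xs. xs ! 1"])
  show "recl 2 (\<lambda>xs. a (xs ! 0))" by (intro recl_comp1[OF assms(1)] recl_proj) simp
  have "recl (2 + 2) (\<lambda>ys. g (ys ! 0) (ys ! 1) (ys ! 2))"
    by (intro recl_comp3[OF assms(2)] recl_proj) auto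
  then show "recl (2 + 2) (\<lambda>ys. g (ys ! 0) (ys ! 1) (drop 2 ys ! 0))"
    by (rule recl_cong) simp
qed (simp add: recl_proj)

lemma rec1_Least:
  assumes "rec2 f" "\<And>x. \<exists>n. f n x = 0" shows "rec1 (\<lambda>x. LEAST n. f n x = 0)"
  unfolding rec1_def
proof (rule recl_Least[where f = "\<lambda>n xs. f n (xs ! 0)"])
  have "recl (1 + 1) (\<lambda>ys. f (ys ! 0) (ys ! 1))"
    by (intro recl_comp2[OF assms(1)] recl_proj) auto
  then show "recl (1 + 1) (\<lambda>ys. f (ys ! 0) (tl ys ! 0))"
    by (rule recl_cong) (simp add: nth_tl)
qed (use assms in auto)

lemma rec1_pred: "rec1 (\<lambda>n. n - 1)"
proof -
  have "rec1 (\<lambda>n. rec_nat 0 (\<lambda>m r. m) n)"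
    by (intro rec1_prec rec2I rec_intros) simp
  moreover have "rec_nat 0 (\<lambda>m r. m) n = n - 1" for n :: nat
    by (cases n) auto
  ultimately show ?thesis by simp
qed
lemmas [rec_intros] = recl_comp1[OF rec1_pred]

lemma rec2_add: "rec2 (+)"
proof -
  have "rec2 (\<lambda>x n. rec_nat x (\<lambda>m r. Suc r) n)"
    by (intro rec2_prec rec1I rec3I rec_intros) auto
  moreover have "rec_nat x (\<lambda>m. Suc) n = x + n" for x n :: nat
    by (induction n) auto
  ultimately show ?thesis by simp
qed
lemmas [rec_intros] = recl_comp2[OF rec2_add]

lemma rec2_minus: "rec2 (-)"
proof -
  have "rec2 (\<lambda>x n. rec_nat x (\<lambda>m r. r - 1) n)"
    by (intro rec2_prec rec1I rec3I rec_intros) auto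
  moreover have "rec_nat x (\<lambda>m r. r - 1) n = x - n" for x n :: nat
    by (induction n) auto
  ultimately show ?thesis by simp
qed
lemmas [rec_intros] = recl_comp2[OF rec2_minus]

lemma rec2_mult: "rec2 (*)"
proof -
  have "rec2 (\<lambda>x n. rec_nat 0 (\<lambda>m r. r + x) n)"
    by (intro rec2_prec rec1I rec3I rec_intros) auto
  moreover have "rec_nat 0 (\<lambda>m r. r + x) n = x * n" for x n :: nat
    by (induction n) auto
  ultimately show ?thesis by simp
qed
lemmas [rec_intros] = recl_comp2[OF rec2_mult]

definition recp :: "nat \<Rightarrow> (nat list \<Rightarrow> bool) \<Rightarrow> bool" where
  "recp k P \<longleftrightarrow> recl k (\<lambda>xs. of_bool (P xs))"

lemma recp_le [rec_intros]:
  assumes "recl k f" "recl k g" shows "recp k (\<lambda>xs. f xs \<le> g xs)"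
proof -
  have "recl k (\<lambda>xs. 1 - (f xs - g xs))" using assms by (intro rec_intros)
  moreover have "1 - (f xs - g xs) = of_bool (f xs \<le> g xs)" for xs by auto
  ultimately show ?thesis unfolding recp_def by simp
qed

lemma recp_not [rec_intros]:
  assumes "recp k P" shows "recp k (\<lambda>xs. \<not> P xs)"
proof -
  have "recl k (\<lambda>xs. 1 - of_bool (P xs))"
    using assms unfolding recp_def by (intro rec_intros)
  moreover have "1 - of_bool (P xs) = (of_bool (\<not> P xs) :: nat)" for xs by simp
  ultimately show ?thesis unfolding recp_def by simp
qed

lemma recp_conj [rec_intros]:
  assumes "recp k P" "recp k Q" shows "recp k (\<lambda>xs. P xs \<and> Q xs)"
proof -
  have "recl k (\<lambda>xs. of_bool (P xs) * of_bool (Q xs))"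
    using assms unfolding recp_def by (intro rec_intros)
  then show ?thesis unfolding recp_def by (simp add: of_bool_conj)
qed

lemma recp_eq [rec_intros]:
  assumes "recl k f" "recl k g" shows "recp k (\<lambda>xs. f xs = g xs)"
  unfolding order_eq_iff by (intro rec_intros assms)

lemma recp_less [rec_intros]:
  assumes "recl k f" "recl k g" shows "recp k (\<lambda>xs. f xs < g xs)"
  unfolding linorder_not_le[symmetric] by (intro rec_intros assms)

lemma recp_disj [rec_intros]:
  assumes "recp k P" "recp k Q" shows "recp k (\<lambda>xs. P xs \<or> Q xs)"
proof -
  have "recp k (\<lambda>xs. \<not> (\<not> P xs \<and> \<not> Q xs))" by (intro rec_intros assms)
  then show ?thesis by simp
qed

lemma recl_if [rec_intros]:
  assumes "recp k P" "recl k f" "recl k g" shows "recl k (\<lambda>xs. if P xs then f xs else g xs)"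
proof -
  have "recl k (\<lambda>xs. of_bool (P xs) * f xs + (1 - of_bool (P xs)) * g xs)"
    using assms unfolding recp_def by (intro rec_intros)
  moreover have "of_bool (P xs) * f xs + (1 - of_bool (P xs)) * g xs = (if P xs then f xs else g xs)" for xs
    by simp
  ultimately show ?thesis by simp
qed

lemma rec1_LeastP:
  assumes "recp 2 (\<lambda>xs. P (xs ! 0) (xs ! 1))" "\<And>x. \<exists>n. P n x" shows "rec1 (\<lambda>x. LEAST n. P n x)"
proof -
  have "rec1 (\<lambda>x. LEAST n. (if P n x then 0 else 1) = (0::nat))"
    using assms by (intro rec1_Least rec2I rec_intros) auto
  then show ?thesis by (simp cong: if_cong split: if_splits)
qed

lemma rec1_div2: "rec1 (\<lambda>n. n div 2)"
proof -
  have "rec1 (\<lambda>n. LEAST m. n < 2 * Suc m)"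
  proof (intro rec1_LeastP rec_intros)
    show "\<exists>m. n < 2 * Suc m" for n by (intro exI[of _ n]) simp
  qed auto
  moreover have "(LEAST m. n < 2 * Suc m) = n div 2" for n :: nat
    by (rule Least_equality) auto
  ultimately show ?thesis by simp
qed
lemmas [rec_intros] = recl_comp1[OF rec1_div2]

lemma recp_even [rec_intros]:
  assumes "recl k f" shows "recp k (\<lambda>xs. even (f xs))"
proof -
  have "recp k (\<lambda>xs. 2 * (f xs div 2) = f xs)" by (intro rec_intros assms)
  moreover have "2 * (n div 2) = n \<longleftrightarrow> even n" for n :: nat by presburger
  ultimately show ?thesis by simp
qed

section \<open>The pairing function and its inverses\<close>

lemma rec1_triangle: "rec1 triangle"
  unfolding triangle_def[abs_def] by (intro rec1I rec_intros) auto
lemmas [rec_intros] = recl_comp1[OF rec1_triangle]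

abbreviation pair :: "nat \<Rightarrow> nat \<Rightarrow> nat" where "pair a b \<equiv> prod_encode (a, b)"

definition pfst :: "nat \<Rightarrow> nat" where "pfst n = fst (prod_decode n)"
definition psnd :: "nat \<Rightarrow> nat" where "psnd n = snd (prod_decode n)"

lemma pfst_pair [simp]: "pfst (pair a b) = a" and psnd_pair [simp]: "psnd (pair a b) = b"
  and pair_pfst_psnd [simp]: "pair (pfst n) (psnd n) = n"
  by (simp_all add: pfst_def psnd_def)

lemma pfst_le: "pfst n \<le> n" and psnd_le: "psnd n \<le> n"
  using le_prod_encode_1[of "pfst n" "psnd n"] le_prod_encode_2[of "psnd n" "pfst n"] by simp_all

lemma rec2_pair: "rec2 pair"
  unfolding prod_encode_def prod.case by (intro rec2I rec_intros) auto
lemmas [rec_intros] = recl_comp2[OF rec2_pair]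

lemma triangle_mono: "m \<le> n \<Longrightarrow> triangle m \<le> triangle n"
  unfolding triangle_def by (intro div_le_mono mult_le_mono) auto

text \<open>The code \<open>pair a b\<close> lies on the diagonal \<open>a + b\<close>, which starts
  at \<open>triangle (a + b)\<close>. Searching for the diagonal makes both projections
  recursive.\<close>

lemma Least_triangle: "(LEAST s. pair a b < triangle (Suc s)) = a + b"
proof (rule Least_equality)
  show "pair a b < triangle (Suc (a + b))" by (simp add: prod_encode_def)
  fix s assume "pair a b < triangle (Suc s)"
  then have "\<not> Suc s \<le> a + b" using triangle_mono[of "Suc s" "a + b"] by (auto simp: prod_encode_def)
  then show "a + b \<le> s" by simp
qed

lemma rec1_diagonal: "rec1 (\<lambda>n. LEAST s. n < triangle (Suc s))"
proof (intro rec1_LeastP rec_intros)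
  show "\<exists>s. n < triangle (Suc s)" for n
    by (intro exI[of _ n]) simp
qed auto

lemma pfst_eq: "pfst n = n - triangle (LEAST s. n < triangle (Suc s))"
proof -
  have "n = pair (pfst n) (psnd n)" by simp
  then have "n = triangle (pfst n + psnd n) + pfst n" by (simp only: prod_encode_def prod.case)
  moreover have "(LEAST s. n < triangle (Suc s)) = pfst n + psnd n"
    using Least_triangle[of "pfst n" "psnd n"] by (simp only: pair_pfst_psnd)
  ultimately show ?thesis by (metis add_diff_cancel_left')
qed

lemma rec1_pfst: "rec1 pfst"
  unfolding pfst_eq[abs_def]
  by (intro rec1I rec_intros recl_comp1[OF rec1_diagonal]) auto
lemmas [rec_intros] = recl_comp1[OF rec1_pfst]

lemma psnd_eq: "psnd n = (LEAST s. n < triangle (Suc s)) - pfst n"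
  using Least_triangle[of "pfst n" "psnd n"] by (simp only: pair_pfst_psnd add_diff_cancel_left')

lemma rec1_psnd: "rec1 psnd"
  unfolding psnd_eq[abs_def]
  by (intro rec1I rec_intros recl_comp1[OF rec1_diagonal]) auto
lemmas [rec_intros] = recl_comp1[OF rec1_psnd]

section \<open>Codes of finite sequences\<close>

text \<open>Initial segments are coded with the last entry first, which makes appending an entry a
  simple operation on codes.\<close>

primrec pre :: "(nat \<Rightarrow> nat) \<Rightarrow> nat \<Rightarrow> nat" where
  "pre x 0 = 0"
| "pre x (Suc n) = Suc (pair (x n) (pre x n))"

definition hdc :: "nat \<Rightarrow> nat" where "hdc c = pfst (c - 1)"
definition tlc :: "nat \<Rightarrow> nat" where "tlc c = psnd (c - 1)"
definition dropc :: "nat \<Rightarrow> nat \<Rightarrow> nat" where "dropc c m = rec_nat c (\<lambda>_ r. tlc r) m"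
definition lenc :: "nat \<Rightarrow> nat" where "lenc c = (LEAST m. dropc c m = 0)"
definition look :: "nat \<Rightarrow> nat \<Rightarrow> nat" where "look c i = hdc (dropc c (lenc c - Suc i))"
text \<open>Shifted by one so that 0 can signal a sequence that is too short, which is also the
  convention for realizers below.\<close>

definition look1 :: "nat \<Rightarrow> nat \<Rightarrow> nat" where "look1 c i = (if i < lenc c then Suc (look c i) else 0)"

lemma hdc_Cons [simp]: "hdc (Suc (pair a b)) = a" and tlc_Cons [simp]: "tlc (Suc (pair a b)) = b"
  by (simp_all add: hdc_def tlc_def)

lemma tlc_0 [simp]: "tlc 0 = 0"
  using psnd_le[of 0] by (simp add: tlc_def)

lemma dropc_simps [simp]: "dropc c 0 = c" "dropc c (Suc m) = tlc (dropc c m)"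
  by (simp_all add: dropc_def)

text \<open>Each step lowers a nonzero code, so \<open>c\<close> steps exhaust \<open>c\<close> and
  the search in \<open>lenc\<close> terminates.\<close>

lemma dropc_le: "dropc c m \<le> c - m"
proof (induction m)
  case (Suc m)
  have "tlc d \<le> d - 1" for d using psnd_le[of "d - 1"] by (simp add: tlc_def)
  from this[of "dropc c m"] Suc show ?case by simp
qed simp

lemma pre_eq_0_iff [simp]: "pre x n = 0 \<longleftrightarrow> n = 0"
  by (cases n) auto

lemma dropc_pre: "dropc (pre x n) m = pre x (n - m)"
proof (induction m)
  case (Suc m)
  then show ?case by (cases "n - m") (auto simp: Suc_diff_Suc[symmetric] diff_Suc split: nat.splits)
qed simp

lemma lenc_pre [simp]: "lenc (pre x n) = n"
  unfolding lenc_def by (rule Least_equality) (auto simp: dropc_pre)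

lemma look_pre [simp]: "i < n \<Longrightarrow> look (pre x n) i = x i"
  unfolding look_def by (simp add: dropc_pre)

lemma look1_pre [simp]: "look1 (pre x n) i = (if i < n then Suc (x i) else 0)"
  by (simp add: look1_def)

lemma pre_eq_iff: "pre x n = pre y n \<longleftrightarrow> (\<forall>i<n. x i = y i)"
  by (induction n) (auto simp: less_Suc_eq)

lemma pre_cong: "(\<And>i. i < n \<Longrightarrow> x i = y i) \<Longrightarrow> pre x n = pre y n"
  by (simp add: pre_eq_iff)

lemma pre_look [simp]: "k \<le> n \<Longrightarrow> pre (look (pre x n)) k = pre x k"
  by (rule pre_cong) simp

lemma rec1_hdc: "rec1 hdc" and rec1_tlc: "rec1 tlc"
  unfolding hdc_def[abs_def] tlc_def[abs_def] by (intro rec1I rec_intros; simp)+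
lemmas [rec_intros] = recl_comp1[OF rec1_hdc] recl_comp1[OF rec1_tlc]

lemma rec2_dropc: "rec2 dropc"
  unfolding dropc_def[abs_def] by (intro rec2_prec rec1I rec3I rec_intros) auto
lemmas [rec_intros] = recl_comp2[OF rec2_dropc]

lemma rec1_lenc: "rec1 lenc"
  unfolding lenc_def[abs_def]
proof (intro rec1_LeastP rec_intros)
  show "\<exists>m. dropc c m = 0" for c
    using dropc_le[of c c] by auto
qed auto
lemmas [rec_intros] = recl_comp1[OF rec1_lenc]

lemma rec2_look: "rec2 look"
  unfolding look_def[abs_def] by (intro rec2I rec_intros) auto
lemmas [rec_intros] = recl_comp2[OF rec2_look]

lemma rec2_look1: "rec2 look1"
  unfolding look1_def[abs_def] by (intro rec2I rec_intros) auto
lemmas [rec_intros] = recl_comp2[OF rec2_look1]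

lemma pre_eq_rec: "pre x n = rec_nat 0 (\<lambda>m r. Suc (pair (x m) r)) n"
  by (induction n) auto

lemma rec2_pre:
  assumes "rec2 h" shows "rec2 (\<lambda>a n. pre (\<lambda>i. h i a) n)"
  unfolding pre_eq_rec by (intro rec2_prec rec1I rec3I rec_intros recl_comp2[OF assms]) auto

lemma rec3_pre:
  assumes "rec3 h" shows "rec3 (\<lambda>a b n. pre (\<lambda>i. h i a b) n)"
  unfolding pre_eq_rec rec3_def
proof (rule recl_rec[where g = "\<lambda>m r xs. Suc (pair (h m (xs ! 0) (xs ! 1)) r)"
    and a = "\<lambda>_. 0" and n = "\<lambda>xs. xs ! 2"])
  have "recl (3 + 2) (\<lambda>ys. Suc (pair (h (ys ! 0) (ys ! 2) (ys ! 3)) (ys ! 1)))"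
    by (intro rec_intros recl_comp3[OF assms] recl_proj) auto
  then show "recl (3 + 2) (\<lambda>ys. Suc (pair (h (ys ! 0) (drop 2 ys ! 0) (drop 2 ys ! 1)) (ys ! 1)))"
    by (rule recl_cong) simp
qed (auto intro: rec_intros)

section \<open>Computable maps between represented types\<close>

text \<open>Every object is represented by a point of the Baire space, so that one notion of
  computability from finite information serves numbers, points and tuples of both. A number becomes
  a constant sequence and a pair an interleaving.\<close>

class coded = fixes enc :: "'a \<Rightarrow> nat \<Rightarrow> nat"

text \<open>The class below has the single instance \<open>nat\<close>; it makes the type of the Baire
  space, which is a function type, an instance of \<open>coded\<close>.\<close>

class natural = fixes to_nat' :: "'a \<Rightarrow> nat" and from_nat' :: "nat \<Rightarrow> 'a"

instantiation nat :: natural begin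
definition "to_nat' = (\<lambda>n::nat. n)"
definition "from_nat' = (\<lambda>n::nat. n)"
instance ..
end

instantiation nat :: coded begin
definition "enc n = (\<lambda>_::nat. n::nat)"
instance ..
end

instantiation "fun" :: (natural, natural) coded begin
definition "enc f = (\<lambda>n. to_nat' (f (from_nat' n)))"
instance ..
end

instantiation prod :: (coded, coded) coded begin
definition "enc p = (\<lambda>i. if even i then enc (fst p) (i div 2) else enc (snd p) (i div 2))"
instance ..
end

lemma enc_nat [simp]: "enc (n::nat) i = n" by (simp add: enc_nat_def)
lemma enc_baire [simp]: "enc (x::baire) = x"
  by (simp add: enc_fun_def to_nat'_nat_def from_nat'_nat_def)
lemma enc_prod: "enc (a, b) i = (if even i then enc a (i div 2) else enc b (i div 2))"
  by (simp add: enc_prod_def)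
lemma enc_prod_even [simp]: "enc p (2 * i) = enc (fst p) i"
  and enc_prod_odd [simp]: "enc p (Suc (2 * i)) = enc (snd p) i"
  by (simp_all add: enc_prod_def)

text \<open>The value 0 of \<open>\<phi>\<close> means that the initial segment of \<open>x\<close> is too short to determine \<open>y n\<close>.\<close>

definition realizes :: "(nat \<Rightarrow> nat \<Rightarrow> nat) \<Rightarrow> baire \<Rightarrow> baire \<Rightarrow> bool" where
  "realizes \<phi> x y \<longleftrightarrow> (\<forall>n k. \<phi> (pre x k) n = 0 \<or> \<phi> (pre x k) n = Suc (y n)) \<and>
     (\<forall>n. \<exists>K. \<forall>k\<ge>K. \<phi> (pre x k) n \<noteq> 0)"

definition cf :: "('a::coded \<Rightarrow> 'b::coded) \<Rightarrow> bool" where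
  "cf f \<longleftrightarrow> (\<exists>\<phi>. rec2 \<phi> \<and> (\<forall>x. realizes \<phi> (enc x) (enc (f x))))"

lemma realizesD:
  assumes "realizes \<phi> x y" "\<phi> (pre x k) n \<noteq> 0" shows "\<phi> (pre x k) n = Suc (y n)"
proof -
  have "\<phi> (pre x k) n = 0 \<or> \<phi> (pre x k) n = Suc (y n)"
    using assms(1)[unfolded realizes_def, THEN conjunct1, THEN spec, THEN spec] .
  with assms(2) show ?thesis by (simp only: simp_thms)
qed

lemma realizes_eventually: "realizes \<phi> x y \<Longrightarrow> \<exists>K. \<forall>k\<ge>K. \<phi> (pre x k) n \<noteq> 0"
  by (simp add: realizes_def)

lemma cfE:
  assumes "cf f" obtains \<phi> where "rec2 \<phi>" "\<And>x. realizes \<phi> (enc x) (enc (f x))"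
proof -
  from assms obtain \<phi> where "rec2 \<phi> \<and> (\<forall>x. realizes \<phi> (enc x) (enc (f x)))"
    unfolding cf_def by (rule exE)
  then show thesis by (intro that[of \<phi>]) simp_all
qed

lemma cf_realizes: "rec2 \<phi> \<Longrightarrow> (\<And>x. realizes \<phi> (enc x) (enc (f x))) \<Longrightarrow> cf f"
  unfolding cf_def by (rule exI[of _ \<phi>]) simp

text \<open>For realizers that answer exactly when the input segment is long enough;
  \<open>B x n\<close> is the required length for the \<open>n\<close>-th value.\<close>

lemma cfI:
  assumes "rec2 \<phi>" "\<And>x n k. \<phi> (pre (enc x) k) n = (if B x n \<le> k then Suc (enc (f x) n) else 0)"
  shows "cf f"
proof (rule cf_realizes[OF assms(1)])
  show "realizes \<phi> (enc x) (enc (f x))" for x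
    unfolding realizes_def assms(2) by auto
qed

lemma cf_comp:
  assumes "cf g" "cf f" shows "cf (\<lambda>x. g (f x))"
proof -
  obtain \<phi> where \<phi>: "rec2 \<phi>" "\<And>x. realizes \<phi> (enc x) (enc (f x))"
    by (rule cfE[OF assms(2)]) (rule that)
  obtain \<psi> where \<psi>: "rec2 \<psi>" "\<And>x. realizes \<psi> (enc x) (enc (g x))"
    by (rule cfE[OF assms(1)]) (rule that)
  \<comment> \<open>\<open>j c\<close> counts how many leading values of the intermediate point are
    determined by \<open>c\<close>. The cap by the length of \<open>c\<close> keeps the minimization
    total.\<close>
  define j where "j c = (LEAST j. \<phi> c j = 0 \<or> lenc c \<le> j)" for c
  define \<eta> where "\<eta> c n = pre (\<lambda>i. \<phi> c i - 1) n" for c n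
  have j1: "rec1 j"
    unfolding j_def[abs_def]
  proof (intro rec1_LeastP rec_intros recl_comp2[OF \<phi>(1)])
    show "\<exists>n. \<phi> x n = 0 \<or> lenc x \<le> n" for x by blast
  qed auto
  have "rec2 (\<lambda>i c. \<phi> c i - 1)"
    by (intro rec2I rec_intros recl_comp2[OF \<phi>(1)]) auto
  then have \<eta>: "rec2 \<eta>" unfolding \<eta>_def[abs_def] by (rule rec2_pre)
  have "rec2 (\<lambda>c n. \<psi> (\<eta> c (j c)) n)"
    by (intro rec2I recl_comp2[OF \<psi>(1)] recl_comp2[OF \<eta>] recl_comp1[OF j1] rec_intros) auto
  then show ?thesis
  proof (rule cf_realizes)
    fix x
    let ?y = "enc (f x)"
    have j: "\<phi> (pre (enc x) k) i = Suc (?y i)" if "i < j (pre (enc x) k)" for i k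
      using not_less_Least[OF that[unfolded j_def]] by (intro realizesD[OF \<phi>(2)]) simp
    have pre: "\<eta> (pre (enc x) k) (j (pre (enc x) k)) = pre ?y (j (pre (enc x) k))" for k
      unfolding \<eta>_def by (rule pre_cong) (simp add: j)
    have "\<exists>K. \<forall>k\<ge>K. \<psi> (pre ?y (j (pre (enc x) k))) n \<noteq> 0" for n
    proof -
      obtain L where L: "\<And>k. k \<ge> L \<Longrightarrow> \<psi> (pre ?y k) n \<noteq> 0"
        using realizes_eventually[OF \<psi>(2)[of "f x"], of n] by blast
      have "\<forall>i. \<exists>K. \<forall>k\<ge>K. \<phi> (pre (enc x) k) i \<noteq> 0"
        using realizes_eventually[OF \<phi>(2)[of x]] by blast
      from choice[OF this] obtain c where c: "\<forall>i. \<forall>k\<ge>c i. \<phi> (pre (enc x) k) i \<noteq> 0"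
        by (elim exE)
      \<comment> \<open>Beyond \<open>K\<close> the first \<open>L\<close> values are all determined
        and the cap is at least \<open>L\<close>, so \<open>j\<close> cannot stop before
        \<open>L\<close>.\<close>
      define K where "K = Max (insert L (c ` {..<L}))"
      have "\<psi> (pre ?y (j (pre (enc x) k))) n \<noteq> 0" if "k \<ge> K" for k
      proof (rule L, rule ccontr)
        assume "\<not> L \<le> j (pre (enc x) k)"
        then have less: "j (pre (enc x) k) < L" by simp
        have "k \<ge> L" "k \<ge> c (j (pre (enc x) k))"
          using that less unfolding K_def by auto
        moreover have "\<phi> (pre (enc x) k) (j (pre (enc x) k)) = 0 \<or>
            lenc (pre (enc x) k) \<le> j (pre (enc x) k)"
          unfolding j_def by (rule LeastI[of _ "lenc (pre (enc x) k)"]) simp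
        moreover have "\<phi> (pre (enc x) k) (j (pre (enc x) k)) \<noteq> 0"
          using c calculation(2) by blast
        ultimately show False using less by simp
      qed
      then show ?thesis by blast
    qed
    moreover have "\<psi> (pre ?y k) n = 0 \<or> \<psi> (pre ?y k) n = Suc (enc (g (f x)) n)" for k n
      using realizesD[OF \<psi>(2)[of "f x"], of k n] by blast
    ultimately show "realizes (\<lambda>c n. \<psi> (\<eta> c (j c)) n) (enc x) (enc (g (f x)))"
      unfolding realizes_def pre by blast
  qed
qed

named_theorems cf_intros

lemma cf_id [cf_intros]: "cf (\<lambda>x. x)"
  by (rule cfI[OF rec2_look1, where B = "\<lambda>x n. Suc n"]) (simp add: Suc_le_eq)

lemma cf_const [cf_intros]: "cf (\<lambda>x. c::nat)"
  by (rule cfI[where B = "\<lambda>x n. 0" and \<phi> = "\<lambda>_ _. Suc c"]) (auto intro!: rec2I rec_intros)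

lemma cf_Pair [cf_intros]:
  assumes "cf f" "cf g" shows "cf (\<lambda>x. (f x, g x))"
proof -
  obtain \<phi> where \<phi>: "rec2 \<phi>" "\<And>x. realizes \<phi> (enc x) (enc (f x))"
    by (rule cfE[OF assms(1)]) (rule that)
  obtain \<psi> where \<psi>: "rec2 \<psi>" "\<And>x. realizes \<psi> (enc x) (enc (g x))"
    by (rule cfE[OF assms(2)]) (rule that)
  define \<xi> where "\<xi> c n = (if even n then \<phi> c (n div 2) else \<psi> c (n div 2))" for c n
  have "rec2 \<xi>"
    unfolding \<xi>_def[abs_def]
    by (intro rec2I rec_intros recl_comp2[OF \<phi>(1)] recl_comp2[OF \<psi>(1)]) auto
  moreover have "realizes \<xi> (enc x) (enc (f x, g x))" for x
  proof -
    have "\<exists>K. \<forall>k\<ge>K. \<xi> (pre (enc x) k) n \<noteq> 0" for n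
      using realizes_eventually[OF \<phi>(2)[of x], of "n div 2"]
        realizes_eventually[OF \<psi>(2)[of x], of "n div 2"]
      unfolding \<xi>_def by (cases "even n") simp_all
    moreover have "\<xi> (pre (enc x) k) n = 0 \<or> \<xi> (pre (enc x) k) n = Suc (enc (f x, g x) n)" for n k
      using realizesD[OF \<phi>(2)[of x], of k "n div 2"] realizesD[OF \<psi>(2)[of x], of k "n div 2"]
      unfolding \<xi>_def enc_prod by presburger
    ultimately show ?thesis unfolding realizes_def by blast
  qed
  ultimately show ?thesis by (rule cf_realizes)
qed

lemma cf_fst [cf_intros]: "cf f \<Longrightarrow> cf (\<lambda>x. fst (f x))"
proof (erule cf_comp[rotated])
  show "cf (fst :: 'b \<times> 'c \<Rightarrow> 'b)"
    by (rule cfI[where \<phi> = "\<lambda>c n. look1 c (2 * n)" and B = "\<lambda>x n. Suc (2 * n)"])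
       (auto intro!: rec2I rec_intros)
qed

lemma cf_snd [cf_intros]: "cf f \<Longrightarrow> cf (\<lambda>x. snd (f x))"
proof (erule cf_comp[rotated])
  show "cf (snd :: 'b \<times> 'c \<Rightarrow> 'c)"
    by (rule cfI[where \<phi> = "\<lambda>c n. look1 c (Suc (2 * n))" and B = "\<lambda>x n. Suc (Suc (2 * n))"])
       (auto intro!: rec2I rec_intros)
qed

lemma cf_enc [cf_intros]: "cf f \<Longrightarrow> cf (\<lambda>x. enc (f x))"
proof (erule cf_comp[rotated])
  show "cf (enc :: 'b \<Rightarrow> nat \<Rightarrow> nat)"
    by (rule cfI[OF rec2_look1, where B = "\<lambda>x n. Suc n"]) (simp add: Suc_le_eq)
qed

lemma cf_rec1:
  assumes "rec1 h" "cf f" shows "cf (\<lambda>x. h (f x))"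
proof (rule cf_comp[OF _ assms(2)])
  have "rec2 (\<lambda>c n. if lenc c = 0 then 0 else Suc (h (look c 0)))"
    by (intro rec2I rec_intros recl_comp1[OF assms(1)]) auto
  then show "cf h"
    by (rule cfI[where B = "\<lambda>x n. 1"]) auto
qed

lemma enc_nat2 [simp]: "enc (p::nat \<times> nat) 0 = fst p" "enc (p::nat \<times> nat) (Suc 0) = snd p"
  by (simp_all add: enc_prod_def)

lemma cf_rec2:
  assumes "rec2 h" "cf f" "cf g" shows "cf (\<lambda>x. h (f x) (g x))"
proof -
  have "rec2 (\<lambda>c n. if lenc c \<le> 1 then 0 else Suc (h (look c 0) (look c 1)))"
    by (intro rec2I rec_intros recl_comp2[OF assms(1)]) auto
  then have "cf (\<lambda>p. h (fst p) (snd p))"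
    by (rule cfI[where B = "\<lambda>x n. 2"]) (auto simp: not_le)
  from cf_comp[OF this cf_Pair[OF assms(2,3)]] show ?thesis by simp
qed

lemma enc_prod_baire_nat [simp]: "enc (p::baire \<times> nat) (2 * i) = fst p i"
    "enc (p::baire \<times> nat) (Suc 0) = snd p"
  by (simp_all add: enc_prod_def)

lemma cf_app:
  assumes "cf f" "cf g" shows "cf (\<lambda>x. (f x :: baire) (g x))"
proof -
  \<comment> \<open>In the encoding of a point and a number, every odd entry is the number and entry
    \<open>2 * i\<close> is the \<open>i\<close>-th value of the point.\<close>
  have "rec2 (\<lambda>c n. if look1 c 1 = 0 then 0 else look1 c (2 * (look1 c 1 - 1)))"
    by (intro rec2I rec_intros) auto
  then have "cf (\<lambda>p::baire \<times> nat. (fst p) (snd p))"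
    by (rule cfI[where B = "\<lambda>p n. max 2 (Suc (2 * snd p))"]) auto
  from cf_comp[OF this cf_Pair[OF assms]] show ?thesis by simp
qed

lemma cf_pre [cf_intros]:
  assumes "cf f" "cf g" shows "cf (\<lambda>x. pre (f x) (g x))"
proof -
  have "rec2 (\<lambda>i c. look c (2 * i))"
    by (intro rec2I rec_intros) auto
  note pre = recl_comp2[OF rec2_pre[OF this]]
  \<comment> \<open>The bound is at least 2, so a segment that does not reach entry 1 is rejected
    whatever \<open>look\<close> returns on it.\<close>
  have "rec2 (\<lambda>c n. if lenc c < 2 * Suc (look c 1) then 0
      else Suc (pre (\<lambda>i. look c (2 * i)) (look c 1)))"
    by (intro rec2I rec_intros pre) auto
  then have "cf (\<lambda>p::baire \<times> nat. pre (fst p) (snd p))"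
  proof (rule cfI[where B = "\<lambda>p n. max 2 (2 * Suc (snd p))"])
    fix p :: "baire \<times> nat" and k n
    let ?c = "pre (enc p) k"
    show "(if lenc ?c < 2 * Suc (look ?c 1) then 0 else Suc (pre (\<lambda>i. look ?c (2 * i)) (look ?c 1)))
      = (if max 2 (2 * Suc (snd p)) \<le> k then Suc (enc (pre (fst p) (snd p)) n) else 0)"
    proof (cases "2 \<le> k")
      case True
      then have l: "look ?c 1 = snd p" by simp
      have "pre (\<lambda>i. look ?c (2 * i)) (snd p) = pre (fst p) (snd p)" if "2 * Suc (snd p) \<le> k"
        by (rule pre_cong) (use that in simp)
      with l show ?thesis by simp
    qed auto
  qed
  from cf_comp[OF this cf_Pair[OF assms]] show ?thesis by simp
qed

text \<open>Currying. From \<open>k\<close> entries of \<open>x\<close> and the number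
  \<open>n\<close> the first \<open>2 * k\<close> entries of the encoding of \<open>(x, n)\<close>
  can be built, and the realizer is run on these. The output is a number, so its entry 0 is
  enough.\<close>

lemma cf_lam:
  fixes f :: "'a::coded \<Rightarrow> nat \<Rightarrow> nat"
  assumes "cf (\<lambda>p. f (fst p) (snd p))" shows "cf (\<lambda>x. (\<lambda>n. f x n))"
proof -
  obtain \<phi> where \<phi>: "rec2 \<phi>"
    "\<And>p::'a \<times> nat. realizes \<phi> (enc p) (enc (f (fst p) (snd p)))"
    by (rule cfE[OF assms]) (rule that)
  define h where "h i c n = (if even i then look c (i div 2) else n)" for i c n :: nat
  have "rec3 h" unfolding h_def[abs_def] by (intro rec3I rec_intros) auto
  note h = recl_comp3[OF rec3_pre[OF this]]
  have "rec2 (\<lambda>c n. \<phi> (pre (\<lambda>i. h i c n) (2 * lenc c)) 0)"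
    by (intro rec2I rec_intros recl_comp2[OF \<phi>(1)] h) auto
  then show ?thesis
  proof (rule cf_realizes)
    fix x :: 'a
    have *: "pre (\<lambda>i. h i (pre (enc x) k) n) (2 * k) = pre (enc (x, n)) (2 * k)" for k n
      by (rule pre_cong) (auto simp: h_def enc_prod)
    have "\<exists>K. \<forall>k\<ge>K. \<phi> (pre (enc (x, n)) (2 * k)) 0 \<noteq> 0" for n :: nat
    proof -
      obtain K where "\<forall>k\<ge>K. \<phi> (pre (enc (x, n)) k) 0 \<noteq> 0"
        using realizes_eventually[OF \<phi>(2)[of "(x, n)"], of 0] by blast
      then show ?thesis by (intro exI[of _ K]) simp
    qed
    moreover have "\<phi> (pre (enc (x, n)) (2 * k)) 0 = 0 \<or> \<phi> (pre (enc (x, n)) (2 * k)) 0 = Suc (f x n)" for k n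
      using realizesD[OF \<phi>(2)[of "(x, n)"], of "2 * k" 0]
      by (cases "\<phi> (pre (enc (x, n)) (2 * k)) 0 = 0") simp_all
    ultimately show "realizes (\<lambda>c n. \<phi> (pre (\<lambda>i. h i c n) (2 * lenc c)) 0) (enc x) (enc (f x))"
      unfolding realizes_def lenc_pre * enc_baire by blast
  qed
qed

text \<open>The way back from represented maps to recursive functions: feed ever longer constant
  sequences to the realizer until it answers.\<close>

lemma rec1_cf:
  fixes f :: "nat \<Rightarrow> nat"
  assumes "cf f" shows "rec1 f"
proof -
  obtain \<phi> where \<phi>: "rec2 \<phi>" "\<And>n::nat. realizes \<phi> (enc n) (enc (f n))"
    by (rule cfE[OF assms]) (rule that)
  have "rec2 (\<lambda>i a. a)" by (intro rec2I rec_intros) auto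
  note pre = recl_comp2[OF rec2_pre[OF this]]
  define k where "k n = (LEAST k. \<phi> (pre (\<lambda>_. n) k) 0 \<noteq> 0)" for n
  have ex: "\<exists>k. \<phi> (pre (\<lambda>_. n) k) 0 \<noteq> 0" for n
    using realizes_eventually[OF \<phi>(2)[of n], of 0] unfolding enc_nat_def by blast
  have k: "rec1 k"
    unfolding k_def[abs_def]
  proof (rule rec1_LeastP)
    show "recp 2 (\<lambda>xs. \<phi> (pre (\<lambda>_. xs ! 1) (xs ! 0)) 0 \<noteq> 0)"
      by (intro rec_intros recl_comp2[OF \<phi>(1)] pre) auto
  qed (rule ex)
  have "rec1 (\<lambda>n. \<phi> (pre (\<lambda>_. n) (k n)) 0 - 1)"
    by (intro rec1I rec_intros recl_comp2[OF \<phi>(1)] pre recl_comp1[OF k]) auto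
  moreover have "\<phi> (pre (\<lambda>_. n) (k n)) 0 - 1 = f n" for n
  proof -
    have "\<phi> (pre (\<lambda>_. n) (k n)) 0 \<noteq> 0" unfolding k_def by (rule LeastI_ex[OF ex])
    then show ?thesis
      using realizesD[OF \<phi>(2)[of n], of "k n" 0] by (simp add: enc_nat_def)
  qed
  ultimately show ?thesis by simp
qed

lemmas [cf_intros] = cf_rec1[OF rec1_Suc] cf_rec1[OF rec1_pfst] cf_rec1[OF rec1_psnd] cf_rec1[OF rec1_hdc]
  cf_rec1[OF rec1_tlc] cf_rec1[OF rec1_lenc] cf_rec1[OF rec1_div2]
  cf_rec2[OF rec2_add] cf_rec2[OF rec2_minus] cf_rec2[OF rec2_mult] cf_rec2[OF rec2_pair]
  cf_rec2[OF rec2_look] cf_rec2[OF rec2_dropc]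

lemma cf_app_fst [cf_intros]: "cf f \<Longrightarrow> cf g \<Longrightarrow> cf (\<lambda>x. fst (f x) (g x :: nat) :: nat)"
  by (rule cf_app[OF cf_fst])

lemma cf_app_snd [cf_intros]: "cf f \<Longrightarrow> cf g \<Longrightarrow> cf (\<lambda>x. snd (f x) (g x :: nat) :: nat)"
  by (rule cf_app[OF cf_snd])

lemma rec2_cf:
  assumes "cf (\<lambda>p. f (fst p) (snd p))" shows "rec2 f"
proof -
  have "cf (\<lambda>n::nat. (pfst n, psnd n))" by (intro cf_intros)
  from rec1_cf[OF cf_comp[OF assms this]] have "rec1 (\<lambda>n. f (pfst n) (psnd n))" by simp
  then have "recl 2 (\<lambda>xs. f (pfst (pair (xs ! 0) (xs ! 1))) (psnd (pair (xs ! 0) (xs ! 1))))"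
    by (rule recl_comp1) (intro rec_intros; simp)
  then show ?thesis by (simp add: rec2_def)
qed

section \<open>Decidable predicates\<close>

definition dec :: "('a::coded \<Rightarrow> bool) \<Rightarrow> bool" where
  "dec P \<longleftrightarrow> cf (\<lambda>x. of_bool (P x) :: nat)"

lemma dec_rec2:
  assumes "recp 2 (\<lambda>xs. P (xs ! 0) (xs ! 1))" "cf f" "cf g" shows "dec (\<lambda>x. P (f x) (g x))"
  unfolding dec_def
proof (rule cf_rec2[where h = "\<lambda>a b. of_bool (P a b)", OF _ assms(2,3)])
  show "rec2 (\<lambda>a b. of_bool (P a b))"
    using assms(1) unfolding rec2_def recp_def .
qed

lemma dec_eq [cf_intros]: "cf f \<Longrightarrow> cf g \<Longrightarrow> dec (\<lambda>x. f x = (g x :: nat))"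
  and dec_le [cf_intros]: "cf f \<Longrightarrow> cf g \<Longrightarrow> dec (\<lambda>x. f x \<le> g x)"
  and dec_less [cf_intros]: "cf f \<Longrightarrow> cf g \<Longrightarrow> dec (\<lambda>x. f x < g x)"
  by (erule dec_rec2[rotated], assumption, intro rec_intros; simp)+

lemma dec_not [cf_intros]:
  assumes "dec P" shows "dec (\<lambda>x. \<not> P x)"
proof -
  have "dec (\<lambda>x. of_bool (P x) = (0::nat))"
    using assms unfolding dec_def[of P] by (intro cf_intros)
  then show ?thesis by simp
qed

lemma dec_conj [cf_intros]:
  assumes "dec P" "dec Q" shows "dec (\<lambda>x. P x \<and> Q x)"
proof -
  have "cf (\<lambda>x. of_bool (P x) * of_bool (Q x) :: nat)"
    using assms unfolding dec_def by (intro cf_intros)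
  then show ?thesis by (simp add: dec_def of_bool_conj)
qed

lemma cf_if [cf_intros]:
  assumes "dec P" "cf f" "cf g" shows "cf (\<lambda>x. if P x then f x else g x :: nat)"
proof -
  have "cf (\<lambda>x. of_bool (P x) * f x + (1 - of_bool (P x)) * g x)"
    using assms unfolding dec_def by (intro cf_intros)
  moreover have "of_bool (P x) * f x + (1 - of_bool (P x)) * g x = (if P x then f x else g x)" for x
    by simp
  ultimately show ?thesis by simp
qed

section \<open>Sigma11 predicates on represented types\<close>

text \<open>\<open>ev\<close> and \<open>od\<close> undo the interleaving of pairs;
  \<open>row\<close> splits one point into countably many. They serve to merge witnesses in the
  closure properties.\<close>

definition ev :: "baire \<Rightarrow> baire" where "ev z = (\<lambda>i. z (2 * i))"
definition od :: "baire \<Rightarrow> baire" where "od z = (\<lambda>i. z (Suc (2 * i)))"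
definition shift :: "baire \<Rightarrow> baire" where "shift z = (\<lambda>i. z (Suc i))"
definition row :: "baire \<Rightarrow> nat \<Rightarrow> baire" where "row z m = (\<lambda>i. z (pair m i))"

lemma ev_enc [simp]: "ev (enc p) = enc (fst p)" and od_enc [simp]: "od (enc p) = enc (snd p)"
  by (simp_all add: ev_def od_def)

lemma shift_case_nat [simp]: "shift (case_nat a z) = z"
  by (simp add: shift_def)

lemma row_rows [simp]: "row (\<lambda>i. Z (pfst i) (psnd i)) m = Z m"
  by (simp add: row_def)

lemma cf_ev [cf_intros]: assumes "cf f" shows "cf (\<lambda>x. ev (f x))"
proof (rule cf_comp[OF _ assms])
  show "cf ev" unfolding ev_def[abs_def] by (rule cf_lam) (intro cf_intros)
qed

lemma cf_od [cf_intros]: assumes "cf f" shows "cf (\<lambda>x. od (f x))"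
proof (rule cf_comp[OF _ assms])
  show "cf od" unfolding od_def[abs_def] by (rule cf_lam) (intro cf_intros)
qed

lemma cf_shift [cf_intros]: assumes "cf f" shows "cf (\<lambda>x. shift (f x))"
proof (rule cf_comp[OF _ assms])
  show "cf shift" unfolding shift_def[abs_def] by (rule cf_lam) (intro cf_intros)
qed

lemma cf_row [cf_intros]: assumes "cf f" "cf g" shows "cf (\<lambda>x. row (f x) (g x))"
proof -
  have "cf (\<lambda>p. row (fst p) (snd p))" unfolding row_def by (rule cf_lam) (intro cf_intros)
  from cf_comp[OF this cf_Pair[OF assms]] show ?thesis by simp
qed

lemma cf_look_fun [cf_intros]: assumes "cf f" shows "cf (\<lambda>x. look (f x))"
proof (rule cf_comp[OF _ assms])
  show "cf look" by (rule cf_lam) (intro cf_intros)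
qed

text \<open>A projection of a closed set given by a computable matrix. In this form the closure
  properties reduce to manipulations of the witness \<open>z\<close>.\<close>

definition Sig :: "('a::coded \<Rightarrow> bool) \<Rightarrow> bool" where
  "Sig P \<longleftrightarrow> (\<exists>F. cf F \<and> (\<forall>x. P x \<longleftrightarrow> (\<exists>z::baire. \<forall>n::nat. F (x, z, n) = (0::nat))))"

lemma SigI:
  assumes "cf (\<lambda>p. F (fst p) (fst (snd p)) (snd (snd p)))"
    "\<And>x. P x \<longleftrightarrow> (\<exists>z::baire. \<forall>n::nat. F x z n = (0::nat))"
  shows "Sig P"
  unfolding Sig_def
  by (rule exI[of _ "\<lambda>p. F (fst p) (fst (snd p)) (snd (snd p))"], rule conjI[OF assms(1)])
     (simp add: assms(2))

lemma SigE:
  assumes "Sig P"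
  obtains F where "cf (\<lambda>p. F (fst p) (fst (snd p)) (snd (snd p)))"
    "\<And>x. P x \<longleftrightarrow> (\<exists>z::baire. \<forall>n::nat. F x z n = (0::nat))"
proof -
  from assms obtain F :: "'a \<times> baire \<times> nat \<Rightarrow> nat"
    where F: "cf F \<and> (\<forall>x. P x \<longleftrightarrow> (\<exists>z. \<forall>n. F (x, z, n) = 0))"
    unfolding Sig_def by (rule exE)
  show thesis
    by (rule that[of "\<lambda>x z n. F (x, z, n)"]) (use F in simp_all)
qed

lemma cf_triple:
  assumes "cf (\<lambda>p. F (fst p) (fst (snd p)) (snd (snd p)))" "cf f" "cf g" "cf h"
  shows "cf (\<lambda>x. F (f x) (g x) (h x))"
  using cf_comp[OF assms(1) cf_Pair[OF assms(2) cf_Pair[OF assms(3,4)]]] by simp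

lemma Sig_comp:
  assumes "Sig P" "cf f" shows "Sig (\<lambda>x. P (f x))"
proof -
  obtain F where F: "cf (\<lambda>p. F (fst p) (fst (snd p)) (snd (snd p)))"
    "\<And>x. P x \<longleftrightarrow> (\<exists>z::baire. \<forall>n::nat. F x z n = (0::nat))"
    using assms(1) by (rule SigE) (rule that)
  have "cf (\<lambda>p. F (f (fst p)) (fst (snd p)) (snd (snd p)))"
    by (intro cf_triple[OF F(1)] cf_comp[OF assms(2)] cf_intros)
  then show ?thesis by (rule SigI) (rule F(2))
qed

lemma Sig_cong: "Sig P \<Longrightarrow> (\<And>x. P x \<longleftrightarrow> Q x) \<Longrightarrow> Sig Q"
  by (subgoal_tac "P = Q") (auto intro: ext)

named_theorems sig_intros

lemma Sig_dec: assumes "dec P" shows "Sig P"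
proof (rule SigI)
  have "dec (\<lambda>p. P (fst p))"
    using assms unfolding dec_def by (rule cf_comp) (intro cf_intros)
  then show "cf (\<lambda>p. if P (fst p) then 0 else 1 :: nat)" by (intro cf_intros)
qed simp

lemma Sig_conj [sig_intros]:
  assumes "Sig P" "Sig Q" shows "Sig (\<lambda>x. P x \<and> Q x)"
proof -
  obtain F where F: "cf (\<lambda>p. F (fst p) (fst (snd p)) (snd (snd p)))"
    "\<And>x. P x \<longleftrightarrow> (\<exists>z::baire. \<forall>n::nat. F x z n = (0::nat))"
    using assms(1) by (rule SigE) (rule that)
  obtain G where G: "cf (\<lambda>p. G (fst p) (fst (snd p)) (snd (snd p)))"
    "\<And>x. Q x \<longleftrightarrow> (\<exists>z::baire. \<forall>n::nat. G x z n = (0::nat))"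
    using assms(2) by (rule SigE) (rule that)
  have "cf (\<lambda>p. F (fst p) (ev (fst (snd p))) (snd (snd p)) + G (fst p) (od (fst (snd p))) (snd (snd p)))"
    by (intro cf_triple[OF F(1)] cf_triple[OF G(1)] cf_intros)
  then show ?thesis
  proof (rule SigI)
    fix x
    show "P x \<and> Q x \<longleftrightarrow> (\<exists>z. \<forall>n. F x (ev z) n + G x (od z) n = 0)"
    proof
      assume "P x \<and> Q x"
      then obtain z w where "\<forall>n. F x z n = 0" "\<forall>n. G x w n = 0" unfolding F(2) G(2) by blast
      then show "\<exists>z. \<forall>n. F x (ev z) n + G x (od z) n = 0" by (intro exI[of _ "enc (z, w)"]) simp
    next
      assume "\<exists>z. \<forall>n. F x (ev z) n + G x (od z) n = 0"
      then show "P x \<and> Q x" unfolding F(2) G(2) by auto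
    qed
  qed
qed

text \<open>The number becomes the first value of the witness.\<close>

lemma Sig_ex_nat [sig_intros]:
  assumes "Sig (\<lambda>p. P (fst p) (snd p))" shows "Sig (\<lambda>x. \<exists>n::nat. P x n)"
proof -
  obtain F where F: "cf (\<lambda>p. F (fst p) (fst (snd p)) (snd (snd p)))"
    "\<And>p. P (fst p) (snd p) \<longleftrightarrow> (\<exists>z::baire. \<forall>n::nat. F p z n = (0::nat))"
    using assms by (rule SigE) (rule that)
  have "cf (\<lambda>p. F (fst p, fst (snd p) 0) (shift (fst (snd p))) (snd (snd p)))"
    by (intro cf_triple[OF F(1)] cf_intros)
  then show ?thesis
  proof (rule SigI)
    fix x
    show "(\<exists>n. P x n) \<longleftrightarrow> (\<exists>z. \<forall>n. F (x, z 0) (shift z) n = 0)"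
    proof
      assume "\<exists>n. P x n"
      then obtain n z where "\<forall>m. F (x, n) z m = 0" using F(2)[of "(x, n)" for n] by auto
      then show "\<exists>z. \<forall>n. F (x, z 0) (shift z) n = 0" by (intro exI[of _ "case_nat n z"]) simp
    next
      assume "\<exists>z. \<forall>n. F (x, z 0) (shift z) n = 0"
      then show "\<exists>n. P x n" using F(2)[of "(x, n)" for n] by auto
    qed
  qed
qed

lemma Sig_ex_baire [sig_intros]:
  assumes "Sig (\<lambda>p. P (fst p) (snd p))" shows "Sig (\<lambda>x. \<exists>y::baire. P x y)"
proof -
  obtain F where F: "cf (\<lambda>p. F (fst p) (fst (snd p)) (snd (snd p)))"
    "\<And>p. P (fst p) (snd p) \<longleftrightarrow> (\<exists>z::baire. \<forall>n::nat. F p z n = (0::nat))"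
    using assms by (rule SigE) (rule that)
  have "cf (\<lambda>p. F (fst p, ev (fst (snd p))) (od (fst (snd p))) (snd (snd p)))"
    by (intro cf_triple[OF F(1)] cf_intros)
  then show ?thesis
  proof (rule SigI)
    fix x
    show "(\<exists>y. P x y) \<longleftrightarrow> (\<exists>z. \<forall>n. F (x, ev z) (od z) n = 0)"
    proof
      assume "\<exists>y. P x y"
      then obtain y z where "\<forall>m. F (x, y) z m = 0" using F(2)[of "(x, y)" for y] by auto
      then show "\<exists>z. \<forall>n. F (x, ev z) (od z) n = 0" by (intro exI[of _ "enc (y, z)"]) simp
    next
      assume "\<exists>z. \<forall>n. F (x, ev z) (od z) n = 0"
      then show "\<exists>y. P x y" using F(2)[of "(x, y)" for y] by auto
    qed
  qed
qed

text \<open>Countable choice provides a witness for each \<open>n\<close>; these become the rows of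
  a single witness.\<close>

lemma Sig_all_nat [sig_intros]:
  assumes "Sig (\<lambda>p. P (fst p) (snd p))" shows "Sig (\<lambda>x. \<forall>n::nat. P x n)"
proof -
  obtain F where F: "cf (\<lambda>p. F (fst p) (fst (snd p)) (snd (snd p)))"
    "\<And>p. P (fst p) (snd p) \<longleftrightarrow> (\<exists>z::baire. \<forall>n::nat. F p z n = (0::nat))"
    using assms by (rule SigE) (rule that)
  have "cf (\<lambda>p. F (fst p, pfst (snd (snd p))) (row (fst (snd p)) (pfst (snd (snd p)))) (psnd (snd (snd p))))"
    by (intro cf_triple[OF F(1)] cf_intros)
  then show ?thesis
  proof (rule SigI)
    fix x
    show "(\<forall>n. P x n) \<longleftrightarrow> (\<exists>z. \<forall>n. F (x, pfst n) (row z (pfst n)) (psnd n) = 0)"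
    proof
      assume "\<forall>n. P x n"
      then have "\<forall>n. \<exists>z. \<forall>m. F (x, n) z m = 0" using F(2)[of "(x, n)" for n] by auto
      from choice[OF this] obtain Z where "\<forall>n m. F (x, n) (Z n) m = 0" by blast
      then show "\<exists>z. \<forall>n. F (x, pfst n) (row z (pfst n)) (psnd n) = 0"
        by (intro exI[of _ "\<lambda>i. Z (pfst i) (psnd i)"]) simp
    next
      assume "\<exists>z. \<forall>n. F (x, pfst n) (row z (pfst n)) (psnd n) = 0"
      then obtain z where z: "\<forall>n. F (x, pfst n) (row z (pfst n)) (psnd n) = 0" by blast
      show "\<forall>n. P x n"
      proof
        fix n
        have "F (x, n) (row z n) m = 0" for m using z[THEN spec, of "pair n m"] by simp
        then show "P x n" using F(2)[of "(x, n)"] by auto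
      qed
    qed
  qed
qed

text \<open>The first value of the witness selects the disjunct.\<close>

lemma Sig_disj [sig_intros]:
  assumes "Sig P" "Sig Q" shows "Sig (\<lambda>x. P x \<or> Q x)"
proof -
  obtain F where F: "cf (\<lambda>p. F (fst p) (fst (snd p)) (snd (snd p)))"
    "\<And>x. P x \<longleftrightarrow> (\<exists>z::baire. \<forall>n::nat. F x z n = (0::nat))"
    using assms(1) by (rule SigE) (rule that)
  obtain G where G: "cf (\<lambda>p. G (fst p) (fst (snd p)) (snd (snd p)))"
    "\<And>x. Q x \<longleftrightarrow> (\<exists>z::baire. \<forall>n::nat. G x z n = (0::nat))"
    using assms(2) by (rule SigE) (rule that)
  have "cf (\<lambda>p. if fst (snd p) 0 = 0 then F (fst p) (shift (fst (snd p))) (snd (snd p))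
      else G (fst p) (shift (fst (snd p))) (snd (snd p)))"
    by (intro cf_triple[OF F(1)] cf_triple[OF G(1)] cf_intros)
  then show ?thesis
  proof (rule SigI)
    fix x
    show "P x \<or> Q x \<longleftrightarrow> (\<exists>z. \<forall>n. (if z 0 = 0 then F x (shift z) n else G x (shift z) n) = 0)"
    proof
      assume "P x \<or> Q x"
      then show "\<exists>z. \<forall>n. (if z 0 = 0 then F x (shift z) n else G x (shift z) n) = 0"
      proof
        assume "P x"
        then obtain z where "\<forall>n. F x z n = 0" unfolding F(2) by blast
        then show ?thesis by (intro exI[of _ "case_nat 0 z"]) simp
      next
        assume "Q x"
        then obtain z where "\<forall>n. G x z n = 0" unfolding G(2) by blast
        then show ?thesis by (intro exI[of _ "case_nat 1 z"]) simp
      qed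
    next
      assume "\<exists>z. \<forall>n. (if z 0 = 0 then F x (shift z) n else G x (shift z) n) = 0"
      then obtain z where "\<forall>n. (if z 0 = 0 then F x (shift z) n else G x (shift z) n) = 0" ..
      then show "P x \<or> Q x" unfolding F(2) G(2) by (cases "z 0 = 0") auto
    qed
  qed
qed

lemma Sig_imp:
  assumes "dec P" "Sig Q" shows "Sig (\<lambda>x. P x \<longrightarrow> Q x)"
proof -
  have "Sig (\<lambda>x. \<not> P x \<or> Q x)" by (intro sig_intros Sig_dec cf_intros assms)
  then show ?thesis by (rule Sig_cong) blast
qed

section \<open>Delta11 predicates\<close>

definition Del :: "('a::coded \<Rightarrow> bool) \<Rightarrow> bool" where
  "Del P \<longleftrightarrow> Sig P \<and> Sig (\<lambda>x. \<not> P x)"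

lemma Del_dec: "dec P \<Longrightarrow> Del P"
  unfolding Del_def by (intro conjI Sig_dec cf_intros)

lemma Del_not [sig_intros]: "Del P \<Longrightarrow> Del (\<lambda>x. \<not> P x)"
  unfolding Del_def by simp

lemma Del_conj [sig_intros]: "Del P \<Longrightarrow> Del Q \<Longrightarrow> Del (\<lambda>x. P x \<and> Q x)"
  unfolding Del_def de_Morgan_conj by (intro conjI sig_intros) auto

lemma Del_disj [sig_intros]: "Del P \<Longrightarrow> Del Q \<Longrightarrow> Del (\<lambda>x. P x \<or> Q x)"
  unfolding Del_def de_Morgan_disj by (intro conjI sig_intros) auto

lemma Del_imp [sig_intros]: "Del P \<Longrightarrow> Del Q \<Longrightarrow> Del (\<lambda>x. P x \<longrightarrow> Q x)"
  unfolding imp_conv_disj by (intro sig_intros)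

lemma Del_all_nat [sig_intros]: "Del (\<lambda>p. P (fst p) (snd p)) \<Longrightarrow> Del (\<lambda>x. \<forall>n::nat. P x n)"
  unfolding Del_def not_all by (intro conjI sig_intros) auto

lemma Del_comp: "Del P \<Longrightarrow> cf f \<Longrightarrow> Del (\<lambda>x. P (f x))"
  unfolding Del_def by (auto intro: Sig_comp[where f = f] Sig_comp[where f = f and P = "\<lambda>x. \<not> P x"])

lemma Del_Sig: "Del P \<Longrightarrow> Sig P" and Del_Sig_not: "Del P \<Longrightarrow> Sig (\<lambda>x. \<not> P x)"
  unfolding Del_def by simp_all

subsection \<open>Normal forms\<close>

text \<open>A realizer answers 0 (undecided) or the successor of the value. Hence the value is 0
  exactly when no initial segment gives an answer above 1, which exhibits the matrix as a closed
  condition.\<close>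

lemma Sig_realizer:
  assumes "Sig (P :: 'a::coded \<Rightarrow> bool)"
  obtains \<phi> where "rec2 \<phi>" "\<And>x. P x \<longleftrightarrow> (\<exists>z::baire. \<forall>(n::nat) k. \<phi> (pre (enc (x, z, n)) k) 0 \<le> 1)"
proof -
  from assms obtain F :: "'a \<times> baire \<times> nat \<Rightarrow> nat"
    where F: "cf F \<and> (\<forall>x. P x \<longleftrightarrow> (\<exists>z. \<forall>n. F (x, z, n) = 0))"
    unfolding Sig_def by (rule exE)
  obtain \<phi> where \<phi>: "rec2 \<phi>" "\<And>p. realizes \<phi> (enc p) (enc (F p))"
    by (rule cfE[OF conjunct1[OF F]]) (rule that)
  have "F p = 0 \<longleftrightarrow> (\<forall>k. \<phi> (pre (enc p) k) 0 \<le> 1)" for p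
  proof
    assume "F p = 0"
    then have "\<phi> (pre (enc p) k) 0 \<noteq> 0 \<Longrightarrow> \<phi> (pre (enc p) k) 0 = 1" for k
      using realizesD[OF \<phi>(2)[of p], of k 0] by simp
    then show "\<forall>k. \<phi> (pre (enc p) k) 0 \<le> 1" by (metis le_eq_less_or_eq less_one not_le)
  next
    assume *: "\<forall>k. \<phi> (pre (enc p) k) 0 \<le> 1"
    obtain k where "\<phi> (pre (enc p) k) 0 \<noteq> 0"
      using realizes_eventually[OF \<phi>(2)[of p], of 0] by blast
    with realizesD[OF \<phi>(2)[of p] this] * show "F p = 0"
      by (metis One_nat_def Suc_le_mono enc_nat le_zero_eq)
  qed
  with F have "P x \<longleftrightarrow> (\<exists>z::baire. \<forall>(n::nat) k. \<phi> (pre (enc (x, z, n)) k) 0 \<le> 1)" for x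
    by simp
  with \<phi>(1) show thesis by (rule that)
qed

lemma pre_enc_prod:
  assumes "pre (enc a) k = pre (enc a') k" "pre (enc b) k = pre (enc b') k"
  shows "pre (enc (a, b)) k = pre (enc (a', b')) k"
  using assms unfolding pre_eq_iff enc_prod by auto

text \<open>A sequence of length \<open>m\<close> bounds the amount of information used; \<open>m\<close> itself
  codes the arguments \<open>n\<close> and \<open>k\<close> of the realizer, which are at most \<open>m\<close>.\<close>

lemma all_pair: "(\<forall>m. Q (pfst m) (psnd m)) \<longleftrightarrow> (\<forall>n k. Q n k)"
  by (metis pfst_pair psnd_pair)

lemma ex_pair: "(\<exists>m. Q (pfst m) (psnd m)) \<longleftrightarrow> (\<exists>n k. Q n k)"
  by (metis pfst_pair psnd_pair)

lemma Sig_tree: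
  fixes P :: "'a::coded \<Rightarrow> bool"
  assumes "Sig P"
  obtains r :: "'a \<Rightarrow> nat \<Rightarrow> nat" where "cf (\<lambda>p::'a \<times> nat. r (fst p) (snd p))"
    "\<And>x. P x \<longleftrightarrow> (\<exists>z. \<forall>m. r x (pre z m) = (0::nat))"
proof -
  obtain \<phi> where \<phi>: "rec2 \<phi>"
    "\<And>x. P x \<longleftrightarrow> (\<exists>z::baire. \<forall>(n::nat) k. \<phi> (pre (enc (x, z, n)) k) 0 \<le> 1)"
    by (rule Sig_realizer[OF assms]) (rule that)
  define r where "r x s = \<phi> (pre (enc (x, look s, pfst (lenc s))) (psnd (lenc s))) 0 - 1" for x :: 'a and s
  have "cf (\<lambda>p::'a \<times> nat. r (fst p) (snd p))"
    unfolding r_def by (intro cf_intros cf_rec2[OF \<phi>(1)])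
  moreover have "r x (pre z m) = \<phi> (pre (enc (x, z, pfst m)) (psnd m)) 0 - 1" for x z m
    unfolding r_def lenc_pre
    by (subst pre_enc_prod[OF refl pre_enc_prod, of "look (pre z m)" _ z]) (simp_all add: psnd_le)
  then have "(\<forall>m. r x (pre z m) = 0) \<longleftrightarrow> (\<forall>(n::nat) k. \<phi> (pre (enc (x, z, n)) k) 0 \<le> 1)" for x z
    using all_pair[of "\<lambda>(n::nat) k. \<phi> (pre (enc (x, z, n)) k) 0 \<le> 1"] by (simp only: diff_is_0_eq)
  then have "P x \<longleftrightarrow> (\<exists>z. \<forall>m. r x (pre z m) = (0::nat))" for x
    by (simp only: \<phi>(2))
  ultimately show thesis by (rule that)
qed

text \<open>In contrast to \<open>Sig_tree\<close>, the point \<open>x\<close> too enters only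
  through a segment of length \<open>m\<close>. So one recursive function on numbers describes the
  predicate, as the universal predicate and the category argument require.\<close>

lemma Sig_tree_baire:
  assumes "Sig (P :: baire \<Rightarrow> bool)"
  obtains r where "rec2 r" "\<And>x. P x \<longleftrightarrow> (\<exists>z. \<forall>m. r (pre x m) (pre z m) = 0)"
proof -
  obtain \<phi> where \<phi>: "rec2 \<phi>"
    "\<And>x. P x \<longleftrightarrow> (\<exists>z::baire. \<forall>(n::nat) k. \<phi> (pre (enc (x, z, n)) k) 0 \<le> 1)"
    by (rule Sig_realizer[OF assms]) (rule that)
  define r where "r a s = \<phi> (pre (enc (look a, look s, pfst (lenc s))) (psnd (lenc s))) 0 - 1" for a s
  have "rec2 r"
    unfolding r_def[abs_def] by (intro rec2_cf cf_intros cf_rec2[OF \<phi>(1)])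
  moreover have "r (pre x m) (pre z m) = \<phi> (pre (enc (x, z, pfst m)) (psnd m)) 0 - 1" for x z m
    unfolding r_def lenc_pre
    by (subst pre_enc_prod[OF _ pre_enc_prod, of "look (pre x m)" _ x "look (pre z m)" z])
       (simp_all add: psnd_le)
  then have "(\<forall>m. r (pre x m) (pre z m) = 0) \<longleftrightarrow> (\<forall>(n::nat) k. \<phi> (pre (enc (x, z, n)) k) 0 \<le> 1)" for x z
    using all_pair[of "\<lambda>(n::nat) k. \<phi> (pre (enc (x, z, n)) k) 0 \<le> 1"] by (simp only: diff_is_0_eq)
  then have "P x \<longleftrightarrow> (\<exists>z. \<forall>m. r (pre x m) (pre z m) = 0)" for x
    by (simp only: \<phi>(2))
  ultimately show thesis by (rule that)
qed

subsection \<open>Comparison with the lightface pointclasses\<close>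

lemma dropc_list_encode: "dropc (list_encode xs) m = list_encode (drop m xs)"
proof (induction m)
  case (Suc m)
  have "tlc (list_encode ys) = list_encode (tl ys)" for ys by (cases ys) auto
  with Suc show ?case by (simp add: drop_Suc tl_drop)
qed simp

lemma lenc_eq: "lenc c = length (list_decode c)"
proof -
  have "list_encode ys = 0 \<longleftrightarrow> ys = []" for ys by (cases ys) auto
  then have "lenc (list_encode xs) = length xs" for xs
    unfolding lenc_def dropc_list_encode by (intro Least_equality) auto
  from this[of "list_decode c"] show ?thesis by simp
qed

text \<open>\<open>look\<close> counts from the end of a code, as suits \<open>pre\<close>;
  \<open>nthc\<close> counts from the front, the order used by \<open>list_encode\<close> and hence
  by \<open>baire_basis\<close>.\<close>

definition nthc :: "nat \<Rightarrow> nat \<Rightarrow> nat" where "nthc c i = hdc (dropc c i)"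

lemma nthc_eq: "i < length (list_decode c) \<Longrightarrow> nthc c i = list_decode c ! i"
  using dropc_list_encode[of "list_decode c" i]
  by (simp add: nthc_def Cons_nth_drop_Suc[symmetric])

lemma cf_nthc [cf_intros]: "cf f \<Longrightarrow> cf g \<Longrightarrow> cf (\<lambda>x. nthc (f x) (g x))"
  unfolding nthc_def by (intro cf_intros)

lemma cf_nthc_fun [cf_intros]: assumes "cf f" shows "cf (\<lambda>x. nthc (f x))"
proof (rule cf_comp[OF _ assms])
  show "cf nthc" by (rule cf_lam) (intro cf_intros)
qed

lemma baire_basis_iff: "x \<in> baire_basis c \<longleftrightarrow> (\<forall>i. i < lenc c \<longrightarrow> x i = nthc c i)"
  by (auto simp: baire_basis_def lenc_eq nthc_eq)

lemma Del_baire_basis [sig_intros]: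
  assumes "cf f" "cf g" shows "Del (\<lambda>x. f x \<in> baire_basis (g x))"
proof -
  have "Del (\<lambda>p. fst p \<in> baire_basis (snd p))"
    unfolding baire_basis_iff by (intro Del_all_nat Del_imp Del_dec cf_intros)
  from Del_comp[OF this cf_Pair[OF assms]] show ?thesis by simp
qed

lemma recfn2_rec2: "recfn 2 f \<Longrightarrow> rec2 (\<lambda>a b. f [a, b])"
  unfolding rec2_def
proof (rule recl_cong[OF recl_recfn])
  show "f xs = f [xs ! 0, xs ! 1]" if "length xs = 2" for xs
    using that by (auto simp: numeral_2_eq_2 length_Suc_conv)
qed

lemma Sig_sigma11:
  assumes "sigma11 (prod_basis baire_basis baire_basis) A" shows "Sig (\<lambda>p. p \<in> A)"
proof -
  let ?B = "prod_basis (prod_basis baire_basis baire_basis) baire_basis"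
  obtain F W f where F: "A = {x. \<exists>z. (x, z) \<in> F}" "- F = (\<Union>c\<in>W. ?B c)"
    and f: "recfn 2 f" "W = {n. \<exists>m. f [m, n] = 0}"
    using assms unfolding sigma11_def pi01_def sigma01_def rec_enumerable_def by blast
  have B: "((x, y), z) \<in> ?B c \<longleftrightarrow> x \<in> baire_basis (pfst (pfst c)) \<and> y \<in> baire_basis (psnd (pfst c))
      \<and> z \<in> baire_basis (psnd c)" for x y z c
    by (simp add: prod_basis_def pfst_def psnd_def)
  have "Sig (\<lambda>p. \<exists>z. \<forall>c m. f [m, c] = 0 \<longrightarrow> \<not> (fst p \<in> baire_basis (pfst (pfst c)) \<and>
      snd p \<in> baire_basis (psnd (pfst c)) \<and> z \<in> baire_basis (psnd c)))"
    by (intro Sig_ex_baire Sig_all_nat Sig_imp Del_Sig_not sig_intros cf_intros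
        cf_rec2[OF recfn2_rec2[OF f(1)]])
  then show ?thesis
  proof (rule Sig_cong)
    fix p :: "baire \<times> baire"
    obtain x y where p: "p = (x, y)" by (cases p)
    have "((x, y), z) \<in> F \<longleftrightarrow> (\<forall>c m. f [m, c] = 0 \<longrightarrow> ((x, y), z) \<notin> ?B c)" for z
      using F(2) unfolding f(2) by blast
    then show "(\<exists>z. \<forall>c m. f [m, c] = 0 \<longrightarrow> \<not> (fst p \<in> baire_basis (pfst (pfst c)) \<and>
      snd p \<in> baire_basis (psnd (pfst c)) \<and> z \<in> baire_basis (psnd c))) \<longleftrightarrow> p \<in> A"
      unfolding F(1) p B by simp
  qed
qed

lemma sigma11_Sig:
  assumes "Sig (\<lambda>p. p \<in> A)" shows "sigma11 (prod_basis baire_basis baire_basis) A"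
proof -
  let ?B = "prod_basis (prod_basis baire_basis baire_basis) baire_basis"
  obtain \<phi> where \<phi>: "rec2 \<phi>"
    "\<And>p. p \<in> A \<longleftrightarrow> (\<exists>z::baire. \<forall>(n::nat) k. \<phi> (pre (enc (p, z, n)) k) 0 \<le> 1)"
    by (rule Sig_realizer[OF assms]) (rule that)
  \<comment> \<open>Sequences of length at least \<open>k\<close> fix the first \<open>k\<close>
    entries of the encoding on the whole box. \<open>Q\<close> says that the realizer has seen a
    nonzero value by then, so the box is disjoint from the closed set.\<close>
  define Q where "Q a b d n k \<longleftrightarrow> k \<le> lenc a \<and> k \<le> lenc b \<and> k \<le> lenc d \<and>
    1 < \<phi> (pre (enc ((nthc a, nthc b), nthc d, n)) k) 0" for a b d n k :: nat
  define w where "w m c = (if Q (pfst (pfst c)) (psnd (pfst c)) (psnd c) (pfst m) (psnd m) then 0 else 1 :: nat)" for m c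
  have "rec2 w"
    unfolding w_def[abs_def] Q_def by (intro rec2_cf cf_intros cf_rec2[OF \<phi>(1)])
  then obtain g where g: "recfn 2 g" "\<And>xs. length xs = 2 \<Longrightarrow> w (xs ! 0) (xs ! 1) = g xs"
    unfolding rec2_def recl_def by blast
  have gw: "g [m, c] = w m c" for m c using g(2)[of "[m, c]"] by simp
  define W where "W = {n. \<exists>m. g [m, n] = 0}"
  have W: "c \<in> W \<longleftrightarrow> (\<exists>n k. Q (pfst (pfst c)) (psnd (pfst c)) (psnd c) n k)" for c
    using ex_pair[of "Q (pfst (pfst c)) (psnd (pfst c)) (psnd c)"] unfolding W_def gw w_def by simp
  define F :: "((baire \<times> baire) \<times> baire) set"
    where "F = {(p, z). \<forall>(n::nat) k. \<phi> (pre (enc (p, z, n)) k) 0 \<le> 1}"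
  have Q: "Q a b d n k \<longleftrightarrow> k \<le> lenc a \<and> k \<le> lenc b \<and> k \<le> lenc d \<and>
    1 < \<phi> (pre (enc ((x, y), z, n)) k) 0"
    if "x \<in> baire_basis a" "y \<in> baire_basis b" "z \<in> baire_basis d" for x y z a b d n k
  proof -
    have "pre (enc ((nthc a, nthc b), nthc d, n)) k = pre (enc ((x, y), z, n)) k"
      if "k \<le> lenc a" "k \<le> lenc b" "k \<le> lenc d"
      by (intro pre_enc_prod refl)
        (use that \<open>x \<in> _\<close> \<open>y \<in> _\<close> \<open>z \<in> _\<close> in \<open>auto simp: baire_basis_iff pre_eq_iff\<close>)
    then show ?thesis unfolding Q_def by auto
  qed
  have B: "((x, y), z) \<in> ?B c \<longleftrightarrow> x \<in> baire_basis (pfst (pfst c)) \<and> y \<in> baire_basis (psnd (pfst c))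
      \<and> z \<in> baire_basis (psnd c)" for x y z c
    by (simp add: prod_basis_def pfst_def psnd_def)
  have "((x, y), z) \<notin> F \<longleftrightarrow> (\<exists>c\<in>W. ((x, y), z) \<in> ?B c)" for x y z
  proof
    assume "((x, y), z) \<notin> F"
    then obtain n k :: nat where nk: "1 < \<phi> (pre (enc ((x, y), z, n)) k) 0"
      unfolding F_def mem_Collect_eq prod.case not_all not_le by blast
    define l where "l x = list_encode (map x [0..<k])" for x :: baire
    have l: "x \<in> baire_basis (l x)" "lenc (l x) = k" for x
      by (simp_all add: l_def baire_basis_def lenc_eq)
    have "Q (l x) (l y) (l z) n k"
      using nk Q[of x "l x" y "l y" z "l z" n k] l by simp
    then have "pair (pair (l x) (l y)) (l z) \<in> W" unfolding W by auto
    moreover have "((x, y), z) \<in> ?B (pair (pair (l x) (l y)) (l z))" unfolding B using l by simp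
    ultimately show "\<exists>c\<in>W. ((x, y), z) \<in> ?B c" by blast
  next
    assume "\<exists>c\<in>W. ((x, y), z) \<in> ?B c"
    then obtain c n k where "Q (pfst (pfst c)) (psnd (pfst c)) (psnd c) n k" "((x, y), z) \<in> ?B c"
      using W by blast
    then have "1 < \<phi> (pre (enc ((x, y), z, n)) k) 0" using Q B by blast
    then show "((x, y), z) \<notin> F" unfolding F_def by (auto simp: not_le)
  qed
  then have "- F = (\<Union>c\<in>W. ?B c)" by auto
  moreover have "rec_enumerable W" unfolding rec_enumerable_def using g(1) W_def by blast
  ultimately have "pi01 ?B F" unfolding pi01_def sigma01_def by blast
  moreover have "A = {x. \<exists>z. (x, z) \<in> F}" using \<phi>(2) unfolding F_def by auto
  ultimately show ?thesis unfolding sigma11_def by blast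
qed

lemma delta11_iff_Del: "delta11_rel A \<longleftrightarrow> Del (\<lambda>p. p \<in> A)"
  using Sig_sigma11[of A] sigma11_Sig[of A] Sig_sigma11[of "- A"] sigma11_Sig[of "- A"]
  unfolding delta11_def pi11_def Del_def by auto

section \<open>A universal Sigma11 predicate\<close>

abbreviation consc :: "nat \<Rightarrow> nat \<Rightarrow> nat" where "consc n a \<equiv> Suc (pair n a)"

text \<open>Programs are numbers \<open>pair t (pair p q)\<close>; the tag \<open>t\<close> selects zero, successor, projection,
  construction of an argument list, composition, primitive recursion and minimalization, in this
  order. The predicate \<open>evaluator v\<close> says that \<open>v (pair e a)\<close> is the value of the program \<open>e\<close> on
  the coded list \<open>a\<close>, where a minimalization without solution has the value 0.\<close>

definition evaluator :: "baire \<Rightarrow> bool" where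
  "evaluator v \<longleftrightarrow> (\<forall>t p q a.
    (t = 0 \<longrightarrow> v (pair (pair t (pair p q)) a) = 0) \<and>
    (t = 1 \<longrightarrow> v (pair (pair t (pair p q)) a) = Suc (hdc a)) \<and>
    (t = 2 \<longrightarrow> v (pair (pair t (pair p q)) a) = nthc a p) \<and>
    (t = 3 \<longrightarrow> v (pair (pair t (pair p q)) a) = consc (v (pair p a)) (v (pair q a))) \<and>
    (t = 4 \<longrightarrow> v (pair (pair t (pair p q)) a) = v (pair p (v (pair q a)))) \<and>
    (t = 5 \<longrightarrow> hdc a = 0 \<longrightarrow> v (pair (pair t (pair p q)) a) = v (pair p (tlc a))) \<and>
    (t = 5 \<longrightarrow> hdc a \<noteq> 0 \<longrightarrow> v (pair (pair t (pair p q)) a) =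
        v (pair q (consc (hdc a - 1)
          (consc (v (pair (pair t (pair p q)) (consc (hdc a - 1) (tlc a)))) (tlc a))))) \<and>
    (t = 6 \<longrightarrow> (\<forall>j. v (pair p (consc j a)) \<noteq> 0) \<and> v (pair (pair t (pair p q)) a) = 0 \<or>
        v (pair p (consc (v (pair (pair t (pair p q)) a)) a)) = 0 \<and>
        (\<forall>i. i < v (pair (pair t (pair p q)) a) \<longrightarrow> v (pair p (consc i a)) \<noteq> 0)))"

lemma Del_evaluator: "Del evaluator"
  unfolding evaluator_def[abs_def] by (intro sig_intros Del_dec cf_intros)

text \<open>Every tag that takes subprograms is positive, so subprograms have smaller numbers;
  \<open>evalc\<close> terminates for this reason.\<close>

lemma less_pair: "0 < t \<Longrightarrow> x < pair t x"
proof -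
  assume "0 < t"
  have "n \<le> triangle n" for n by (induction n) auto
  from this[of "t + x"] \<open>0 < t\<close> show ?thesis by (simp add: prod_encode_def)
qed

lemma psnd_less: "0 < pfst e \<Longrightarrow> psnd e < e"
  using less_pair[of "pfst e" "psnd e"] by simp

text \<open>Witnesses that an evaluator exists. It is not meant to be recursive: the clause for
  minimization asks whether a solution exists.\<close>

function evalc :: "nat \<Rightarrow> nat \<Rightarrow> nat" where
  "evalc e = (if pfst e = 0 then (\<lambda>a. 0)
    else if pfst e = 1 then (\<lambda>a. Suc (hdc a))
    else if pfst e = 2 then (\<lambda>a. nthc a (pfst (psnd e)))
    else if pfst e = 3 then (\<lambda>a. consc (evalc (pfst (psnd e)) a) (evalc (psnd (psnd e)) a))
    else if pfst e = 4 then (\<lambda>a. evalc (pfst (psnd e)) (evalc (psnd (psnd e)) a))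
    else if pfst e = 5 then (\<lambda>a. rec_nat (evalc (pfst (psnd e)) (tlc a))
      (\<lambda>n r. evalc (psnd (psnd e)) (consc n (consc r (tlc a)))) (hdc a))
    else (\<lambda>a. if \<exists>j. evalc (pfst (psnd e)) (consc j a) = 0
      then LEAST j. evalc (pfst (psnd e)) (consc j a) = 0 else 0))"
  by pat_completeness auto
termination
  by (relation "Wellfounded.measure id")
     (auto intro: le_less_trans[OF pfst_le psnd_less] le_less_trans[OF psnd_le psnd_less])

declare evalc.simps [simp del]

lemma evalc_pair: "evalc (pair t (pair p q)) = (if t = 0 then (\<lambda>a. 0)
    else if t = 1 then (\<lambda>a. Suc (hdc a))
    else if t = 2 then (\<lambda>a. nthc a p)
    else if t = 3 then (\<lambda>a. consc (evalc p a) (evalc q a))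
    else if t = 4 then (\<lambda>a. evalc p (evalc q a))
    else if t = 5 then (\<lambda>a. rec_nat (evalc p (tlc a)) (\<lambda>n r. evalc q (consc n (consc r (tlc a)))) (hdc a))
    else (\<lambda>a. if \<exists>j. evalc p (consc j a) = 0 then LEAST j. evalc p (consc j a) = 0 else 0))"
  by (subst evalc.simps) (simp only: pfst_pair psnd_pair)

lemma evaluator_exists: "\<exists>v. evaluator v"
proof
  let ?v = "\<lambda>i. evalc (pfst i) (psnd i)"
  have *: "?v (pair (pair t (pair p q)) a) = evalc (pair t (pair p q)) a" for t p q a by simp
  show "evaluator ?v"
    unfolding evaluator_def *
  proof (intro allI conjI impI)
    fix t p q a
    assume t: "t = (6::nat)"
    let ?P = "\<lambda>j. evalc p (consc j a) = 0"
    have e: "evalc (pair t (pair p q)) a = (if \<exists>j. ?P j then LEAST j. ?P j else 0)"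
      unfolding evalc_pair t by simp
    show "(\<forall>j. ?v (pair p (consc j a)) \<noteq> 0) \<and> evalc (pair t (pair p q)) a = 0 \<or>
        ?v (pair p (consc (evalc (pair t (pair p q)) a) a)) = 0 \<and>
        (\<forall>i. i < evalc (pair t (pair p q)) a \<longrightarrow> ?v (pair p (consc i a)) \<noteq> 0)"
    proof (cases "\<exists>j. ?P j")
      case True
      then have "evalc (pair t (pair p q)) a = (LEAST j. ?P j)" unfolding e by (rule if_P)
      moreover from LeastI_ex[OF True] have "?P (LEAST j. ?P j)" .
      moreover have "\<not> ?P i" if "i < (LEAST j. ?P j)" for i using not_less_Least[OF that] .
      ultimately show ?thesis by (simp only: pfst_pair psnd_pair) blast
    next
      case False
      then have "evalc (pair t (pair p q)) a = 0" unfolding e by (rule if_not_P)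
      with False show ?thesis by (simp only: pfst_pair psnd_pair) simp
    qed
  next
    fix t p q a
    assume t: "t = (5::nat)" and "hdc a \<noteq> 0"
    then obtain n where n: "hdc a = Suc n" by (cases "hdc a") auto
    have "evalc (pair t (pair p q)) b = rec_nat (evalc p (tlc b))
      (\<lambda>n r. evalc q (consc n (consc r (tlc b)))) (hdc b)" for b
      unfolding evalc_pair t by simp
    then show "evalc (pair t (pair p q)) a = ?v (pair q (consc (hdc a - 1)
          (consc (evalc (pair t (pair p q)) (consc (hdc a - 1) (tlc a))) (tlc a))))"
      using n by simp
  qed (simp_all add: evalc_pair)
qed

text \<open>The program is chosen before the evaluator, so all evaluators agree on it.\<close>

lemma evaluator_recfn:
  assumes "recfn k f"
  shows "\<exists>e. \<forall>v xs. evaluator v \<longrightarrow> length xs = k \<longrightarrow> v (pair e (list_encode xs)) = f xs"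
  using assms
proof (induction rule: recfn.induct)
  case (zero k)
  have "v (pair (pair 0 (pair 0 0)) a) = 0" if "evaluator v" for v a
    using that[unfolded evaluator_def, THEN spec[of _ 0]] by blast
  then show ?case by blast
next
  case succ
  have "v (pair (pair 1 (pair 0 0)) a) = Suc (hdc a)" if "evaluator v" for v a
    using that[unfolded evaluator_def, THEN spec[of _ 1]] by blast
  moreover have "hdc (list_encode xs) = hd xs" if "length xs = 1" for xs
    using that by (cases xs) auto
  ultimately show ?case by metis
next
  case (proj i k)
  have "v (pair (pair 2 (pair i 0)) a) = nthc a i" if "evaluator v" for v a
    using that[unfolded evaluator_def, THEN spec[of _ 2]] by blast
  moreover have "nthc (list_encode xs) i = xs ! i" if "length xs = k" for xs
    using nthc_eq[of i "list_encode xs"] that \<open>i < k\<close> by simp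
  ultimately show ?case by metis
next
  case (comp m f gs k)
  obtain p where p: "\<And>v xs. evaluator v \<Longrightarrow> length xs = m \<Longrightarrow> v (pair p (list_encode xs)) = f xs"
    using comp.IH(1) by blast
  \<comment> \<open>A program for the list of arguments is put together with tag 3, starting from
    the zero program because the empty list has code 0.\<close>
  have "\<exists>e. \<forall>v xs. evaluator v \<longrightarrow> length xs = k \<longrightarrow>
      v (pair e (list_encode xs)) = list_encode (map (\<lambda>g. g xs) hs)" if "set hs \<subseteq> set gs" for hs
    using that
  proof (induction hs)
    case Nil
    have "v (pair (pair 0 (pair 0 0)) a) = 0" if "evaluator v" for v a
      using that[unfolded evaluator_def, THEN spec[of _ 0]] by blast
    then show ?case by auto
  next
    case (Cons h hs)
    obtain d where d: "\<And>v xs. evaluator v \<Longrightarrow> length xs = k \<Longrightarrow> v (pair d (list_encode xs)) = h xs"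
      using comp Cons.prems by auto
    obtain e where e: "\<And>v xs. evaluator v \<Longrightarrow> length xs = k \<Longrightarrow>
        v (pair e (list_encode xs)) = list_encode (map (\<lambda>g. g xs) hs)"
      using Cons by auto
    have "v (pair (pair 3 (pair d e)) a) = consc (v (pair d a)) (v (pair e a))" if "evaluator v" for v a
      using that[unfolded evaluator_def, THEN spec[of _ 3]] by blast
    then show ?case using d e by (intro exI[of _ "pair 3 (pair d e)"]) simp
  qed
  then obtain q where q: "\<And>v xs. evaluator v \<Longrightarrow> length xs = k \<Longrightarrow>
      v (pair q (list_encode xs)) = list_encode (map (\<lambda>g. g xs) gs)" by blast
  have "v (pair (pair 4 (pair p q)) a) = v (pair p (v (pair q a)))" if "evaluator v" for v a
    using that[unfolded evaluator_def, THEN spec[of _ 4]] by blast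
  then show ?case using p q \<open>length gs = m\<close> by (intro exI[of _ "pair 4 (pair p q)"]) simp
next
  case (prec k f g)
  obtain p where p: "\<And>v xs. evaluator v \<Longrightarrow> length xs = k \<Longrightarrow> v (pair p (list_encode xs)) = f xs"
    using prec.IH(1) by blast
  obtain q where q: "\<And>v xs. evaluator v \<Longrightarrow> length xs = k + 2 \<Longrightarrow> v (pair q (list_encode xs)) = g xs"
    using prec.IH(2) by blast
  let ?e = "pair 5 (pair p q)"
  have "v (pair ?e (list_encode (n # ys))) = rec_nat (f ys) (\<lambda>n r. g (n # r # ys)) n"
    if v: "evaluator v" and len: "length ys = k" for v n ys
  proof (induction n)
    case 0
    have "v (pair ?e a) = v (pair p (tlc a))" if "hdc a = 0" for a
      using v[unfolded evaluator_def, THEN spec[of _ 5]] that by blast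
    then show ?case using p[OF v len] by simp
  next
    case (Suc n)
    have "v (pair ?e a) = v (pair q (consc (hdc a - 1)
          (consc (v (pair ?e (consc (hdc a - 1) (tlc a)))) (tlc a))))" if "hdc a \<noteq> 0" for a
      using v[unfolded evaluator_def, THEN spec[of _ 5]] that by blast
    from this[of "list_encode (Suc n # ys)"] Suc q[OF v, of "n # _ # ys"] len show ?case by simp
  qed
  note * = this
  have "v (pair ?e (list_encode xs)) = rec_nat (f (tl xs)) (\<lambda>n r. g (n # r # tl xs)) (hd xs)"
    if "evaluator v" "length xs = k + 1" for v xs
    using *[OF that(1), of "tl xs" "hd xs"] that(2) by (cases xs) auto
  then show ?case by blast
next
  case (minimize k f)
  obtain p where p: "\<And>v xs. evaluator v \<Longrightarrow> length xs = k + 1 \<Longrightarrow> v (pair p (list_encode xs)) = f xs"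
    using minimize.IH(1) by blast
  let ?e = "pair 6 (pair p 0)"
  have "v (pair ?e (list_encode xs)) = (LEAST n. f (n # xs) = 0)"
    if v: "evaluator v" and len: "length xs = k" for v xs
  proof -
    let ?a = "list_encode xs"
    have pf: "v (pair p (consc j ?a)) = f (j # xs)" for j
      using p[OF v, of "j # xs"] len by simp
    have "(\<forall>j. v (pair p (consc j ?a)) \<noteq> 0) \<and> v (pair ?e ?a) = 0 \<or>
        v (pair p (consc (v (pair ?e ?a)) ?a)) = 0 \<and>
        (\<forall>i. i < v (pair ?e ?a) \<longrightarrow> v (pair p (consc i ?a)) \<noteq> 0)"
      using v[unfolded evaluator_def, THEN spec[of _ 6]] by blast
    moreover have "\<exists>j. f (j # xs) = 0" using minimize len by blast
    ultimately have *: "f (v (pair ?e ?a) # xs) = 0" "\<And>i. i < v (pair ?e ?a) \<Longrightarrow> f (i # xs) \<noteq> 0"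
      unfolding pf by blast+
    show ?thesis
    proof (rule Least_equality[symmetric])
      show "v (pair ?e ?a) \<le> y" if "f (y # xs) = 0" for y using *(2)[of y] that by (meson not_le)
    qed (rule *(1))
  qed
  then show ?case by blast
qed

text \<open>Quantifying over evaluators, which form a Delta11 set, replaces a recursive universal
  function. The nested \<open>consc\<close> term is the code of a list with two entries.\<close>

definition univ :: "nat \<times> baire \<Rightarrow> bool" where
  "univ p \<longleftrightarrow> (\<exists>v. evaluator v \<and>
    (\<exists>z. \<forall>m. v (pair (fst p) (consc (pre (snd p) m) (consc (pre z m) 0))) = 0))"

lemma Sig_univ: "Sig univ"
proof -
  have 1: "Sig (\<lambda>p::(nat \<times> baire) \<times> baire. evaluator (snd p))"
    by (intro Sig_comp[OF Del_Sig[OF Del_evaluator]] cf_intros)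
  have 2: "Sig (\<lambda>p::(nat \<times> baire) \<times> baire. \<exists>z. \<forall>m. snd p (pair (fst (fst p))
      (consc (pre (snd (fst p)) m) (consc (pre z m) 0))) = 0)"
    by (intro Sig_ex_baire Sig_all_nat Sig_dec cf_intros)
  show ?thesis unfolding univ_def[abs_def] by (rule Sig_ex_baire, rule Sig_conj[OF 1 2])
qed

lemma univ_universal:
  assumes "Sig P" shows "\<exists>e. \<forall>x. P x \<longleftrightarrow> univ (e, x)"
proof -
  obtain r where r: "rec2 r" "\<And>x. P x \<longleftrightarrow> (\<exists>z. \<forall>m. r (pre x m) (pre z m) = 0)"
    by (rule Sig_tree_baire[OF assms]) (rule that)
  obtain g where g: "recfn 2 g" "\<And>xs. length xs = 2 \<Longrightarrow> r (xs ! 0) (xs ! 1) = g xs"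
    using r(1) unfolding rec2_def recl_def by blast
  obtain e where e: "\<And>v xs. evaluator v \<Longrightarrow> length xs = 2 \<Longrightarrow> v (pair e (list_encode xs)) = g xs"
    using evaluator_recfn[OF g(1)] by blast
  have "v (pair e (consc a (consc b 0))) = r a b" if "evaluator v" for v a b
    using e[OF that, of "[a, b]"] g(2)[of "[a, b]"] by simp
  then have "(\<exists>z. \<forall>m. v (pair e (consc (pre x m) (consc (pre z m) 0))) = 0) \<longleftrightarrow> P x"
    if "evaluator v" for v x
    using that unfolding r(2) by simp
  then have "P x \<longleftrightarrow> univ (e, x)" for x
    unfolding univ_def fst_conv snd_conv using evaluator_exists by blast
  then show ?thesis by blast
qed

text \<open>Bounds the number of conditions, so that \<open>forces_locally\<close> can combine the
  dense families of all of them.\<close>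

lemma countable_Sig: "countable {A. Sig (\<lambda>x::baire. x \<in> A)}"
proof (rule countable_subset)
  show "{A. Sig (\<lambda>x. x \<in> A)} \<subseteq> range (\<lambda>e. {x. univ (e, x)})"
  proof
    fix A :: "baire set" assume "A \<in> {A. Sig (\<lambda>x. x \<in> A)}"
    then obtain e where "\<forall>x. x \<in> A \<longleftrightarrow> univ (e, x)" using univ_universal by blast
    then have "A = {x. univ (e, x)}" by blast
    then show "A \<in> range (\<lambda>e. {x. univ (e, x)})" by blast
  qed
qed simp

section \<open>Comparison of trees and separation\<close>

definition infpath :: "('a \<Rightarrow> 'a \<Rightarrow> bool) \<Rightarrow> 'a \<Rightarrow> bool" where
  "infpath A s \<longleftrightarrow> (\<exists>t. t 0 = s \<and> (\<forall>m::nat. A (t m) (t (Suc m))))"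

text \<open>Simulation takes the place of the comparison of ranks of wellfounded trees.\<close>

definition sim :: "('a \<Rightarrow> 'a \<Rightarrow> bool) \<Rightarrow> ('b \<Rightarrow> 'b \<Rightarrow> bool) \<Rightarrow> 'a \<Rightarrow> 'b \<Rightarrow> bool" where
  "sim A B s t \<longleftrightarrow> (\<exists>R. R s t \<and> (\<forall>s t. R s t \<longrightarrow> (\<forall>s'. A s s' \<longrightarrow> (\<exists>t'. B t t' \<and> R s' t'))))"

lemma sim_step: "sim A B s t \<Longrightarrow> A s s' \<Longrightarrow> \<exists>t'. B t t' \<and> sim A B s' t'"
  unfolding sim_def by metis

text \<open>Coinduction: \<open>sim\<close> is the largest simulation, so a pair whose successors
  can be matched may be added to it.\<close>

lemma sim_fold:
  assumes "\<And>s'. A s s' \<Longrightarrow> \<exists>t'. B t t' \<and> sim A B s' t'" shows "sim A B s t"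
proof -
  let ?R = "\<lambda>a b. sim A B a b \<or> (a = s \<and> b = t)"
  have "\<forall>a b. ?R a b \<longrightarrow> (\<forall>a'. A a a' \<longrightarrow> (\<exists>b'. B b b' \<and> ?R a' b'))"
    using sim_step[of A B] assms by blast
  then show ?thesis unfolding sim_def[of A B s t] by (intro exI[of _ ?R]) simp
qed

text \<open>Dependent choice on auxiliary states; \<open>h\<close> reads off the node of the
  tree.\<close>

lemma infpath_chain:
  assumes "Q x" "\<And>x. Q x \<Longrightarrow> \<exists>y. Q y \<and> A (h x) (h y)" shows "infpath A (h x)"
proof -
  obtain f where "f 0 = x" "\<And>n. Q (f n)" "\<And>n. A (h (f n)) (h (f (Suc n)))"
    using dependent_nat_choice[of "\<lambda>n y. Q y \<and> (n = 0 \<longrightarrow> y = x)" "\<lambda>n x y. A (h x) (h y)"] assms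
    by (metis nat.distinct(1))
  then show ?thesis unfolding infpath_def by (intro exI[of _ "\<lambda>n. h (f n)"]) simp
qed

text \<open>A player who moves along an infinite branch always has an answer, so every node may be
  related to every point of the branch.\<close>

lemma sim_infpath: "infpath B t \<Longrightarrow> sim A B s t"
proof -
  assume "infpath B t"
  then obtain b where "b 0 = t" "\<forall>m. B (b m) (b (Suc m))" unfolding infpath_def by blast
  then show ?thesis unfolding sim_def by (intro exI[of _ "\<lambda>_ y. \<exists>m. y = b m"]) blast
qed

lemma infpath_sim:
  assumes "sim A B s t" "infpath A s" shows "infpath B t"
proof -
  obtain a where a: "a 0 = s" "\<And>m. A (a m) (a (Suc m))" using assms(2) unfolding infpath_def by blast
  have "infpath B (snd (0::nat, t))"
  proof (rule infpath_chain[where Q = "\<lambda>(m, y). sim A B (a m) y" and h = snd])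
    fix p assume "case p of (m, y) \<Rightarrow> sim A B (a m) y"
    then obtain m y where p: "p = (m, y)" "sim A B (a m) y" by (cases p) auto
    obtain y' where "B y y'" "sim A B (a (Suc m)) y'" using sim_step[OF p(2) a(2)[of m]] by blast
    then show "\<exists>q. (case q of (m, y) \<Rightarrow> sim A B (a m) y) \<and> B (snd p) (snd q)"
      using p(1) by (intro exI[of _ "(Suc m, y')"]) simp
  qed (use a assms in simp)
  then show ?thesis by simp
qed

text \<open>The analogue for ranks: \<open>s\<close> fails to be at most \<open>t\<close> iff
  \<open>t\<close> is at most some child of \<open>s\<close>. If both sides fail, counterexamples
  chosen alternately yield an infinite branch through \<open>t\<close>, and then \<open>s\<close> is
  simulated after all. If both hold, alternating answers yield an infinite branch through
  \<open>s\<close>, which the simulation copies to \<open>t\<close>.\<close>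

lemma not_sim_iff:
  assumes "\<not> (infpath A s \<and> infpath B t)"
  shows "\<not> sim A B s t \<longleftrightarrow> (\<exists>s'. A s s' \<and> sim B A t s')"
proof
  assume ns: "\<not> sim A B s t"
  show "\<exists>s'. A s s' \<and> sim B A t s'"
  proof (rule ccontr)
    assume n: "\<nexists>s'. A s s' \<and> sim B A t s'"
    have "infpath B (snd (s, t))"
    proof (rule infpath_chain[where h = snd and
          Q = "\<lambda>(s, t). \<not> sim A B s t \<and> (\<forall>s'. A s s' \<longrightarrow> \<not> sim B A t s')"])
      fix p assume "case p of (s, t) \<Rightarrow> \<not> sim A B s t \<and> (\<forall>s'. A s s' \<longrightarrow> \<not> sim B A t s')"
      then obtain s t where p: "p = (s, t)" "\<not> sim A B s t" "\<And>s'. A s s' \<Longrightarrow> \<not> sim B A t s'"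
        by auto
      obtain s' where s': "A s s'" "\<And>t'. B t t' \<Longrightarrow> \<not> sim A B s' t'"
        using p(2) sim_fold[of A s B t] by blast
      obtain t' where t': "B t t'" "\<And>s''. A s' s'' \<Longrightarrow> \<not> sim B A t' s''"
        using p(3)[OF s'(1)] sim_fold[of B t A s'] by blast
      show "\<exists>q. (case q of (s, t) \<Rightarrow> \<not> sim A B s t \<and> (\<forall>s'. A s s' \<longrightarrow> \<not> sim B A t s')) \<and> B (snd p) (snd q)"
        using s' t' p(1) by (intro exI[of _ "(s', t')"]) simp
    qed (use ns n in simp)
    then show False using sim_infpath[of B t A s] ns by simp
  qed
next
  assume "\<exists>s'. A s s' \<and> sim B A t s'"
  then obtain s' where s': "A s s'" "sim B A t s'" by blast
  show "\<not> sim A B s t"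
  proof
    assume sim: "sim A B s t"
    have "infpath A (fst (s, t, s'))"
    proof (rule infpath_chain[where h = fst and
          Q = "\<lambda>(s, t, s'). sim A B s t \<and> A s s' \<and> sim B A t s'"])
      fix p assume "case p of (s, t, s') \<Rightarrow> sim A B s t \<and> A s s' \<and> sim B A t s'"
      then obtain s t s' where p: "p = (s, t, s')" "sim A B s t" "A s s'" "sim B A t s'"
        by (cases p) auto
      obtain t' where t': "B t t'" "sim A B s' t'" using sim_step[OF p(2,3)] by blast
      obtain s'' where s'': "A s' s''" "sim B A t' s''" using sim_step[OF p(4) t'(1)] by blast
      show "\<exists>q. (case q of (s, t, s') \<Rightarrow> sim A B s t \<and> A s s' \<and> sim B A t s') \<and> A (fst p) (fst q)"
        using p t' s'' by (intro exI[of _ "(s', t', s'')"]) simp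
    qed (use sim s' in simp)
    then have "infpath A s" by simp
    with infpath_sim[OF sim this] assms show False by blast
  qed
qed

definition step :: "(nat \<Rightarrow> nat) \<Rightarrow> nat \<Rightarrow> nat \<Rightarrow> bool" where
  "step r s s' \<longleftrightarrow> r s = 0 \<and> r s' = 0 \<and> s' \<noteq> 0 \<and> tlc s' = s"

lemma consc_hdc_tlc: "s \<noteq> 0 \<Longrightarrow> consc (hdc s) (tlc s) = s"
  by (simp add: hdc_def tlc_def)

lemma infpath_step: "infpath (step r) 0 \<longleftrightarrow> (\<exists>z. \<forall>m. r (pre z m) = 0)"
proof
  assume "infpath (step r) 0"
  then obtain t where t: "t 0 = 0" "\<And>m. step r (t m) (t (Suc m))" unfolding infpath_def by blast
  have "pre (\<lambda>i. hdc (t (Suc i))) m = t m" for m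
  proof (induction m)
    case (Suc m)
    then show ?case using t(2)[of m] consc_hdc_tlc[of "t (Suc m)"] by (simp add: step_def)
  qed (simp add: t)
  then show "\<exists>z. \<forall>m. r (pre z m) = 0" using t(2) unfolding step_def by metis
next
  assume "\<exists>z. \<forall>m. r (pre z m) = 0"
  then obtain z where z: "\<forall>m. r (pre z m) = 0" ..
  have "step r (pre z m) (pre z (Suc m))" for m
    unfolding step_def using z[THEN spec, of m] z[THEN spec, of "Suc m"] by simp
  then show "infpath (step r) 0"
    unfolding infpath_def by (intro exI[of _ "pre z"]) simp
qed

text \<open>A simulation between trees of numbers is a set of pairs and so a point, which turns
  \<open>sim\<close> into one quantifier over the Baire space.\<close>

lemma sim_baire: "sim A B s t \<longleftrightarrow> (\<exists>R::baire. R (pair s t) = 0 \<and>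
    (\<forall>s t s'. R (pair s t) = 0 \<longrightarrow> A s s' \<longrightarrow> (\<exists>t'. B t t' \<and> R (pair s' t') = 0)))"
  (is "_ \<longleftrightarrow> ?rhs")
proof
  assume "sim A B s t"
  then obtain R where "R s t \<and> (\<forall>s t. R s t \<longrightarrow> (\<forall>s'. A s s' \<longrightarrow> (\<exists>t'. B t t' \<and> R s' t')))"
    unfolding sim_def by blast
  moreover define S :: baire where "S n = (if R (pfst n) (psnd n) then 0 else 1)" for n
  have "S (pair a b) = 0 \<longleftrightarrow> R a b" for a b by (simp add: S_def)
  ultimately show ?rhs by (intro exI[of _ S]) (simp only: simp_thms, blast)
next
  assume ?rhs
  then obtain R :: baire where "R (pair s t) = 0 \<and>
    (\<forall>s t s'. R (pair s t) = 0 \<longrightarrow> A s s' \<longrightarrow> (\<exists>t'. B t t' \<and> R (pair s' t') = 0))" ..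
  then show "sim A B s t" unfolding sim_def by (intro exI[of _ "\<lambda>s t. R (pair s t) = 0"]) blast
qed

lemma cf_pair_fun: "cf (\<lambda>p. r (fst p) (snd p)) \<Longrightarrow> cf f \<Longrightarrow> cf g \<Longrightarrow> cf (\<lambda>x. r (f x) (g x))"
  using cf_comp[of "\<lambda>p. r (fst p) (snd p)", OF _ cf_Pair[of f g]] by simp

lemma dec_step:
  assumes r: "cf (\<lambda>p. r (fst p) (snd p))" and "cf f" "cf g" "cf h"
  shows "dec (\<lambda>x. step (r (f x)) (g x) (h x))"
  unfolding step_def by (intro cf_intros cf_pair_fun[OF r] assms)

lemma Sig_sim:
  assumes r: "cf (\<lambda>p. r (fst p) (snd p))" and q: "cf (\<lambda>p. q (fst p) (snd p))"
    and "cf f" "cf g" "cf h"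
  shows "Sig (\<lambda>x. sim (step (r (f x))) (step (q (f x))) (g x) (h x))"
proof -
  have "Sig (\<lambda>p. sim (step (r (fst p))) (step (q (fst p))) (fst (snd p)) (snd (snd p)))"
    unfolding sim_baire
    by (intro Sig_ex_baire Sig_ex_nat Sig_all_nat Sig_conj Sig_imp Sig_dec dec_step[OF r] dec_step[OF q] cf_intros)
  from Sig_comp[OF this cf_Pair[OF assms(3) cf_Pair[OF assms(4,5)]]] show ?thesis by simp
qed

text \<open>\<open>M w\<close> says that the tree for \<open>A w\<close> simulates into the tree for \<open>B w\<close>; unless both trees have
  infinite branches, the negation is Sigma11 as well.\<close>

lemma Sig_separation:
  fixes A B :: "'a::coded \<Rightarrow> bool"
  assumes "Sig A" "Sig B"
  obtains M N where "Sig M" "Sig N" "\<And>w. \<not> (A w \<and> B w) \<Longrightarrow> \<not> M w \<longleftrightarrow> N w"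
    "\<And>w. B w \<Longrightarrow> M w" "\<And>w. A w \<Longrightarrow> \<not> B w \<Longrightarrow> \<not> M w"
proof -
  obtain r :: "'a \<Rightarrow> nat \<Rightarrow> nat" where r: "cf (\<lambda>p. r (fst p) (snd p))"
    "\<And>w. A w \<longleftrightarrow> (\<exists>z. \<forall>m. r w (pre z m) = 0)"
    by (rule Sig_tree[OF assms(1)]) (rule that)
  obtain q :: "'a \<Rightarrow> nat \<Rightarrow> nat" where q: "cf (\<lambda>p. q (fst p) (snd p))"
    "\<And>w. B w \<longleftrightarrow> (\<exists>z. \<forall>m. q w (pre z m) = 0)"
    by (rule Sig_tree[OF assms(2)]) (rule that)
  have rq: "A w \<longleftrightarrow> infpath (step (r w)) 0" "B w \<longleftrightarrow> infpath (step (q w)) 0" for w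
    by (simp_all only: r(2) q(2) infpath_step)
  define M where "M w \<longleftrightarrow> sim (step (r w)) (step (q w)) 0 0" for w
  \<comment> \<open>The right-hand side of \<open>not_sim_iff\<close>.\<close>
  define N where "N w \<longleftrightarrow> (\<exists>s'. step (r w) 0 s' \<and> sim (step (q w)) (step (r w)) 0 s')" for w
  show thesis
  proof (rule that[of M N])
    show "Sig M" unfolding M_def[abs_def] by (intro Sig_sim[OF r(1) q(1)] cf_intros)
    show "Sig N" unfolding N_def[abs_def]
      by (intro Sig_ex_nat Sig_conj Sig_sim[OF q(1) r(1)] Sig_dec dec_step[OF r(1)] cf_intros)
    show "\<not> (A w \<and> B w) \<Longrightarrow> \<not> M w \<longleftrightarrow> N w" for w
      unfolding M_def N_def rq by (rule not_sim_iff)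
    show "B w \<Longrightarrow> M w" for w unfolding M_def rq by (rule sim_infpath)
    show "A w \<Longrightarrow> \<not> B w \<Longrightarrow> \<not> M w" for w unfolding M_def rq
      using infpath_sim[of "step (r w)" "step (q w)" 0 0] by blast
  qed
qed

section \<open>The union of all Delta11 functions\<close>

definition functional :: "baire set \<Rightarrow> bool" where
  "functional Q \<longleftrightarrow> (\<forall>w w'. w \<in> Q \<longrightarrow> w' \<in> Q \<longrightarrow> ev w = ev w' \<longrightarrow> od w = od w')"

text \<open>Rewrites the value of \<open>g\<close> in \<open>function_cover\<close> as a combination
  of connectives and number quantifiers, under which \<open>Del\<close> is closed.\<close>

lemma Least_else_0_iff:
  "(a::nat) = (if \<exists>k. P k then LEAST k. P k else 0) \<longleftrightarrow>
    (P a \<and> (\<forall>j. j < a \<longrightarrow> \<not> P j)) \<or> (a = 0 \<and> (\<forall>j. \<not> P j))"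
proof (cases "\<exists>k. P k")
  case True
  have "a = (LEAST k. P k) \<longleftrightarrow> P a \<and> (\<forall>j. j < a \<longrightarrow> \<not> P j)"
  proof
    assume "a = (LEAST k. P k)"
    then show "P a \<and> (\<forall>j. j < a \<longrightarrow> \<not> P j)" using LeastI_ex[OF True] not_less_Least by blast
  next
    assume "P a \<and> (\<forall>j. j < a \<longrightarrow> \<not> P j)"
    then show "a = (LEAST k. P k)" by (intro Least_equality[symmetric]) (auto, meson not_le)
  qed
  then show ?thesis unfolding if_P[OF True] using True by blast
qed simp

text \<open>For a code \<open>e\<close> of a functional set of pairs \<open>(x, y)\<close>, the function \<open>g e\<close> is read off a Delta11
  set that separates the triples \<open>(x, n, y n)\<close> from the \<open>(x, n, k)\<close> with \<open>k \<noteq> y n\<close>. The complement of \<open>V\<close>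
  is a union of parts of these functions, defined by a positive use of both Pi11 definitions of
  the separating set.\<close>

lemma function_cover:
  obtains J :: "nat set" and g :: "nat \<Rightarrow> baire \<Rightarrow> baire" and V :: "baire \<times> baire \<Rightarrow> bool"
  where "\<And>j. j \<in> J \<Longrightarrow> delta11_fun (g j)" "Sig V"
    "\<And>x y. \<not> V (x, y) \<Longrightarrow> \<exists>j\<in>J. y = g j x"
    "\<And>Q w. Sig (\<lambda>w. w \<in> Q) \<Longrightarrow> functional Q \<Longrightarrow> w \<in> Q \<Longrightarrow> \<not> V (ev w, od w)"
proof -
  define A where "A p \<longleftrightarrow> (\<exists>y. univ (fst p, enc (fst (snd p), y)) \<and> y (fst (snd (snd p))) = snd (snd (snd p)))"
    for p :: "nat \<times> baire \<times> nat \<times> nat"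
  define B where "B p \<longleftrightarrow> (\<exists>y. univ (fst p, enc (fst (snd p), y)) \<and> y (fst (snd (snd p))) \<noteq> snd (snd (snd p)))"
    for p :: "nat \<times> baire \<times> nat \<times> nat"
  have "Sig A" unfolding A_def[abs_def] by (intro Sig_ex_baire Sig_conj Sig_comp[OF Sig_univ] Sig_dec cf_intros)
  moreover have "Sig B" unfolding B_def[abs_def] by (intro Sig_ex_baire Sig_conj Sig_comp[OF Sig_univ] Sig_dec cf_intros)
  ultimately obtain M N where MN: "Sig M" "Sig N" "\<And>w. \<not> (A w \<and> B w) \<Longrightarrow> \<not> M w \<longleftrightarrow> N w"
    "\<And>w. B w \<Longrightarrow> M w" "\<And>w. A w \<Longrightarrow> \<not> B w \<Longrightarrow> \<not> M w"
    by (rule Sig_separation) (rule that)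
  define J where "J = {e. functional {w. univ (e, w)}}"
  have J: "y = y'" if "e \<in> J" "univ (e, enc (x, y))" "univ (e, enc (x, y'))"
    for e and x y y' :: baire
  proof -
    have "functional {w. univ (e, w)}" using that(1) by (simp only: J_def mem_Collect_eq)
    then have "od (enc (x, y)) = od (enc (x, y'))"
      using that(2,3) unfolding functional_def mem_Collect_eq by (elim allE[of _ "enc (x, y)"] allE[of _ "enc (x, y')"]) simp
    then show ?thesis by simp
  qed
  have disj: "\<not> (A (e, x, n, k) \<and> B (e, x, n, k))" if "e \<in> J" for e x n k
    using J[OF that] unfolding A_def B_def by (metis fst_conv snd_conv)
  have not_J: "e \<notin> J \<longleftrightarrow> (\<exists>w w'. univ (e, w) \<and> univ (e, w') \<and> (\<forall>i. w (2 * i) = w' (2 * i)) \<and>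
      (\<exists>i. w (Suc (2 * i)) \<noteq> w' (Suc (2 * i))))" for e
    unfolding J_def functional_def mem_Collect_eq ev_def od_def fun_eq_iff by blast
  have SJ: "Sig (\<lambda>e. e \<notin> J)"
    unfolding not_J by (intro Sig_ex_baire Sig_ex_nat Sig_all_nat Sig_conj Sig_comp[OF Sig_univ] Sig_dec cf_intros)
  \<comment> \<open>For \<open>e\<close> in \<open>J\<close> the predicates \<open>M\<close> and
    \<open>N\<close> are complementary, so if all disjuncts fail, \<open>M\<close> holds exactly of
    the \<open>k\<close> other than \<open>snd p n\<close>. Membership in \<open>J\<close> is Pi11
    and occurs here negated, which keeps \<open>V\<close> Sigma11.\<close>
  define V where "V p \<longleftrightarrow> (\<forall>e. e \<notin> J \<or> (\<exists>n k. (k = snd p n \<and> M (e, fst p, n, k)) \<or>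
      (k \<noteq> snd p n \<and> N (e, fst p, n, k))))" for p
  \<comment> \<open>The default 0 makes \<open>g e\<close> total, also at points outside the domain
    of the coded set.\<close>
  define g where "g e x n = (if \<exists>k. \<not> M (e, x, n, k) then LEAST k. \<not> M (e, x, n, k) else 0)" for e x n
  show thesis
  proof (rule that[of J g V])
    show "Sig V"
      unfolding V_def[abs_def]
      by (intro Sig_ex_nat Sig_all_nat Sig_conj Sig_disj Sig_comp[OF SJ] Sig_comp[OF MN(1)]
          Sig_comp[OF MN(2)] Sig_dec cf_intros)
  next
    fix x y assume "\<not> V (x, y)"
    then obtain e where e: "e \<in> J" "\<And>n. \<not> M (e, x, n, y n)" "\<And>n k. k \<noteq> y n \<Longrightarrow> \<not> N (e, x, n, k)"
      unfolding V_def by auto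
    have "M (e, x, n, k) \<longleftrightarrow> k \<noteq> y n" for n k
      using MN(3)[OF disj[OF e(1)]] e(2,3) by blast
    then have "y n = g e x n" for n unfolding g_def by (subst Least_else_0_iff) simp
    then have "y = g e x" by (rule ext)
    with e(1) show "\<exists>j\<in>J. y = g j x" by blast
  next
    fix Q w assume Q: "Sig (\<lambda>w. w \<in> Q)" "functional Q" "w \<in> Q"
    obtain e where e: "\<forall>x. x \<in> Q \<longleftrightarrow> univ (e, x)" using univ_universal[OF Q(1)] by blast
    then have "Q = {w. univ (e, w)}" by blast
    with Q(2) have eJ: "e \<in> J" unfolding J_def by simp
    define x y where "x = ev w" and "y = od w"
    have "enc (x, y) = w"
      unfolding x_def y_def enc_prod_def ev_def od_def by (rule ext) auto
    then have u: "univ (e, enc (x, y))" using e Q(3) by simp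
    have B: "B (e, x, n, k) \<longleftrightarrow> k \<noteq> y n" for n k
      unfolding B_def fst_conv snd_conv using J[OF eJ u] u by blast
    have A: "A (e, x, n, k) \<longleftrightarrow> k = y n" for n k
      unfolding A_def fst_conv snd_conv using J[OF eJ u] u by blast
    have "\<not> M (e, x, n, y n)" for n using MN(5) A B by blast
    moreover have "\<not> N (e, x, n, k)" if "k \<noteq> y n" for n k
      using MN(3)[OF disj[OF eJ]] MN(4) B that by blast
    ultimately show "\<not> V (ev w, od w)"
      unfolding V_def x_def[symmetric] y_def[symmetric] using eJ by auto
  next
    fix e assume "e \<in> J"
    then have eq: "\<not> M (e, x, n, k) \<longleftrightarrow> N (e, x, n, k)" for x n k using MN(3)[OF disj] by blast
    have MD: "Del (\<lambda>p. M (e, fst p, fst (snd p), snd (snd p)))"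
      unfolding Del_def eq by (intro conjI Sig_comp[OF MN(1)] Sig_comp[OF MN(2)] cf_intros)
    have MD: "Del (\<lambda>q. M (e, f q, h q, k q))" if "cf f" "cf h" "cf k" for f h k
      using Del_comp[OF MD cf_Pair[OF that(1) cf_Pair[OF that(2,3)]]] by simp
    have "a = g e x n \<longleftrightarrow> (\<not> M (e, x, n, a) \<and> (\<forall>j. j < a \<longrightarrow> M (e, x, n, j))) \<or>
        (a = 0 \<and> (\<forall>j. M (e, x, n, j)))" for a x n
      unfolding g_def by (subst Least_else_0_iff) simp
    then have "(y = g e x) \<longleftrightarrow> (\<forall>n. (\<not> M (e, x, n, y n) \<and> (\<forall>j. j < y n \<longrightarrow> M (e, x, n, j))) \<or>
        (y n = 0 \<and> (\<forall>j. M (e, x, n, j))))" for x y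
      unfolding fun_eq_iff by simp
    moreover have "Del (\<lambda>p. \<forall>n. (\<not> M (e, fst p, n, snd p n) \<and>
        (\<forall>j. j < snd p n \<longrightarrow> M (e, fst p, n, j))) \<or> (snd p n = 0 \<and> (\<forall>j. M (e, fst p, n, j))))"
      by (intro Del_all_nat Del_imp Del_conj Del_disj Del_not MD) (intro Del_dec cf_intros)+
    ultimately have "Del (\<lambda>p. snd p = g e (fst p))" by simp
    then show "delta11_fun (g e)"
      unfolding delta11_fun_def delta11_iff_Del by (simp add: case_prod_beta')
  qed
qed

section \<open>Category for Sigma11 sets\<close>

definition cond :: "baire set \<Rightarrow> bool" where
  "cond P \<longleftrightarrow> P \<noteq> {} \<and> Sig (\<lambda>x. x \<in> P)"

definition dense_below :: "baire set \<Rightarrow> baire set set \<Rightarrow> bool" where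
  "dense_below P D \<longleftrightarrow> (\<forall>Q. cond Q \<longrightarrow> Q \<subseteq> P \<longrightarrow> (\<exists>R\<in>D. cond R \<and> R \<subseteq> Q))"

text \<open>\<open>forces P A\<close> says that \<open>A\<close> is comeager in \<open>P\<close> for the Gandy-Harrington topology, whose basis
  are the Sigma11 sets.\<close>

definition forces :: "baire set \<Rightarrow> baire set \<Rightarrow> bool" where
  "forces P A \<longleftrightarrow> (\<exists>D. (\<forall>n::nat. dense_below P (D n)) \<and>
    (\<forall>x\<in>P. (\<forall>n. \<exists>R\<in>D n. x \<in> R) \<longrightarrow> x \<in> A))"

lemma dense_belowD: "dense_below P D \<Longrightarrow> cond Q \<Longrightarrow> Q \<subseteq> P \<Longrightarrow> \<exists>R\<in>D. cond R \<and> R \<subseteq> Q"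
  unfolding dense_below_def by blast

lemma forcesE:
  assumes "forces P A"
  obtains D where "\<And>n::nat. dense_below P (D n)" "\<forall>x\<in>P. (\<forall>n. \<exists>R\<in>D n. x \<in> R) \<longrightarrow> x \<in> A"
proof -
  from assms obtain D where D: "(\<forall>n::nat. dense_below P (D n)) \<and>
    (\<forall>x\<in>P. (\<forall>n. \<exists>R\<in>D n. x \<in> R) \<longrightarrow> x \<in> A)"
    unfolding forces_def by (rule exE)
  show thesis
    by (rule that[OF conjunct1[OF D, THEN spec] conjunct2[OF D]])
qed

lemma forcesI:
  assumes "\<And>n::nat. dense_below P (D n)" "\<And>x. x \<in> P \<Longrightarrow> (\<And>n. \<exists>R\<in>D n. x \<in> R) \<Longrightarrow> x \<in> A"
  shows "forces P A"
  unfolding forces_def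
proof (intro exI[of _ D] conjI allI ballI impI)
  show "dense_below P (D n)" for n by (rule assms(1))
  show "x \<in> A" if "x \<in> P" "\<forall>n. \<exists>R\<in>D n. x \<in> R" for x
    by (rule assms(2)[OF that(1)]) (rule that(2)[THEN spec])
qed

lemma forces_subset: "P \<subseteq> A \<Longrightarrow> forces P A"
  by (rule forcesI[of P "\<lambda>_. UNIV"]) (auto simp: dense_below_def)

lemma forces_INT:
  assumes "\<And>n::nat. forces P (A n)" shows "forces P (\<Inter>n. A n)"
proof -
  have "\<forall>n. \<exists>D. (\<forall>m::nat. dense_below P (D m)) \<and> (\<forall>x\<in>P. (\<forall>m. \<exists>R\<in>D m. x \<in> R) \<longrightarrow> x \<in> A n)"
    using assms unfolding forces_def by blast
  from choice[OF this] obtain D where D: "\<forall>n. (\<forall>m::nat. dense_below P (D n m)) \<and>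
    (\<forall>x\<in>P. (\<forall>m. \<exists>R\<in>D n m. x \<in> R) \<longrightarrow> x \<in> A n)" ..
  show ?thesis
  proof (rule forcesI[of P "\<lambda>i. D (pfst i) (psnd i)"])
    show "dense_below P (D (pfst i) (psnd i))" for i using D by blast
    fix x assume x: "x \<in> P" "\<And>i. \<exists>R\<in>D (pfst i) (psnd i). x \<in> R"
    have "\<exists>R\<in>D n m. x \<in> R" for n m using x(2)[of "pair n m"] by (simp only: pfst_pair psnd_pair)
    with D x(1) show "x \<in> (\<Inter>n. A n)" by blast
  qed
qed

lemma forces_Int:
  assumes "forces P A" "forces P B" shows "forces P (A \<inter> B)"
proof -
  have "forces P (\<Inter>n::nat. if n = 0 then A else B)"
    by (rule forces_INT) (use assms in simp)
  moreover have "(\<Inter>n::nat. if n = 0 then A else B) = A \<inter> B" by (auto split: if_splits)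
  ultimately show ?thesis by simp
qed

lemma cond_Int: "cond P \<Longrightarrow> cond Q \<Longrightarrow> P \<inter> Q \<noteq> {} \<Longrightarrow> cond (P \<inter> Q)"
  unfolding cond_def Int_iff by (intro conjI Sig_conj) simp_all

text \<open>A set that is comeager on a dense family of open sets is comeager. Because there are
  only countably many conditions, the dense families of all those that force \<open>A\<close> can be
  met together.\<close>

lemma forces_locally:
  assumes P: "cond P" and dense: "dense_below P {R. forces R A}" shows "forces P A"
proof -
  let ?C = "{R. cond R \<and> forces R A}"
  have "countable ?C"
    by (rule countable_subset[OF _ countable_Sig]) (auto simp: cond_def)
  moreover have "?C \<noteq> {}" using dense_belowD[OF dense P] by blast
  ultimately have C: "range (from_nat_into ?C) = ?C" by (rule range_from_nat_into[rotated])
  define R where "R = from_nat_into ?C"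
  have R: "cond (R i)" "forces (R i) A" for i
    using C unfolding R_def by blast+
  have "\<forall>i. \<exists>D. (\<forall>m::nat. dense_below (R i) (D m)) \<and> (\<forall>x\<in>R i. (\<forall>m. \<exists>Q\<in>D m. x \<in> Q) \<longrightarrow> x \<in> A)"
    using R(2) unfolding forces_def by blast
  from choice[OF this] obtain D where D: "\<forall>i. (\<forall>m::nat. dense_below (R i) (D i m)) \<and>
    (\<forall>x\<in>R i. (\<forall>m. \<exists>Q\<in>D i m. x \<in> Q) \<longrightarrow> x \<in> A)" ..
  \<comment> \<open>Admitting the sets disjoint from \<open>R i\<close> extends density from below
    \<open>R i\<close> to below \<open>P\<close>.\<close>
  define E where "E i m = {Q. Q \<in> D i m \<or> Q \<inter> R i = {}}" for i m
  \<comment> \<open>Family 0 puts a generic point into some \<open>R i\<close>; the others make it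
    generic there.\<close>
  define F where "F n = (case n of 0 \<Rightarrow> ?C | Suc k \<Rightarrow> E (pfst k) (psnd k))" for n
  have E: "dense_below P (E i m)" for i m
    unfolding dense_below_def
  proof (intro allI impI)
    fix Q assume Q: "cond Q" "Q \<subseteq> P"
    show "\<exists>S\<in>E i m. cond S \<and> S \<subseteq> Q"
    proof (cases "Q \<inter> R i = {}")
      case True
      then show ?thesis using Q unfolding E_def by blast
    next
      case False
      then have "cond (Q \<inter> R i)" using Q(1) R(1) by (rule cond_Int[rotated 2])
      moreover have "dense_below (R i) (D i m)" using D by blast
      ultimately have "\<exists>S\<in>D i m. cond S \<and> S \<subseteq> Q \<inter> R i" using dense_belowD by blast
      then show ?thesis unfolding E_def by blast
    qed
  qed
  show ?thesis
  proof (rule forcesI[of P F])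
    show "dense_below P (F n)" for n
    proof (cases n)
      case 0
      have "dense_below P ?C" using dense unfolding dense_below_def by blast
      then show ?thesis unfolding F_def 0 by simp
    next
      case (Suc k)
      show ?thesis unfolding F_def Suc using E by simp
    qed
  next
    fix x assume x: "x \<in> P" "\<And>n. \<exists>S\<in>F n. x \<in> S"
    have "\<exists>S\<in>?C. x \<in> S" using x(2)[of 0] unfolding F_def by simp
    then obtain i where i: "x \<in> R i" using C unfolding R_def by blast
    have "\<exists>S\<in>D i m. x \<in> S" for m
    proof -
      have "\<exists>S\<in>E i m. x \<in> S" using x(2)[of "Suc (pair i m)"] unfolding F_def by simp
      with i show ?thesis unfolding E_def by blast
    qed
    with D i show "x \<in> A" by blast
  qed
qed

subsection \<open>The Baire category theorem\<close>

text \<open>The start \<open>n0\<close> is there for the witnesses, since the witness of the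
  \<open>i\<close>-th set exists only from stage \<open>i\<close> on.\<close>

lemma pre_limit:
  assumes "\<And>n. n0 \<le> n \<Longrightarrow> pre (y (Suc n)) n = pre (y n) n"
  shows "\<exists>Y. \<forall>n\<ge>n0. pre Y n = pre (y n) n"
proof -
  have mono: "pre (y (n + d)) n = pre (y n) n" if "n0 \<le> n" for n d
  proof (induction d)
    case (Suc d)
    have "pre (y (Suc (n + d))) (n + d) = pre (y (n + d)) (n + d)" using assms that by simp
    then have "pre (y (Suc (n + d))) n = pre (y (n + d)) n" unfolding pre_eq_iff by simp
    with Suc show ?case by simp
  qed simp
  define Y where "Y i = y (max n0 (Suc i)) i" for i
  have "pre Y n = pre (y n) n" if n: "n0 \<le> n" for n
  proof (rule pre_cong)
    fix i assume i: "i < n"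
    let ?m = "max n0 (Suc i)"
    have "pre (y (?m + (n - ?m))) ?m = pre (y ?m) ?m" by (rule mono) simp
    moreover have "?m + (n - ?m) = n" using n i by simp
    ultimately have "pre (y n) ?m = pre (y ?m) ?m" by simp
    then show "Y i = y n i" unfolding Y_def pre_eq_iff by simp
  qed
  then show ?thesis by blast
qed

definition closed_code :: "(nat \<Rightarrow> nat \<Rightarrow> nat) \<Rightarrow> baire \<Rightarrow> baire \<Rightarrow> bool" where
  "closed_code r x z \<longleftrightarrow> (\<forall>m. r (pre x m) (pre z m) = 0)"

text \<open>A fixed choice, so that all stages of the construction seek a witness in the same closed
  set.\<close>

definition code :: "baire set \<Rightarrow> nat \<Rightarrow> nat \<Rightarrow> nat" where
  "code Q = (SOME r. rec2 r \<and> (\<forall>x. x \<in> Q \<longleftrightarrow> (\<exists>z. closed_code r x z)))"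

lemma code:
  assumes "cond Q"
  shows "rec2 (code Q)" "x \<in> Q \<longleftrightarrow> (\<exists>z. closed_code (code Q) x z)"
proof -
  obtain r where "rec2 r" "\<And>x. x \<in> Q \<longleftrightarrow> (\<exists>z. \<forall>m. r (pre x m) (pre z m) = 0)"
    by (rule Sig_tree_baire[OF conjunct2[OF assms[unfolded cond_def]]]) (rule that)
  then have "\<exists>r. rec2 r \<and> (\<forall>x. x \<in> Q \<longleftrightarrow> (\<exists>z. closed_code r x z))"
    unfolding closed_code_def by blast
  from someI_ex[OF this] have "rec2 (code Q) \<and> (\<forall>x. x \<in> Q \<longleftrightarrow> (\<exists>z. closed_code (code Q) x z))"
    unfolding code_def .
  then show "rec2 (code Q)" "x \<in> Q \<longleftrightarrow> (\<exists>z. closed_code (code Q) x z)" by blast+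
qed

lemma Sig_localized:
  assumes "rec2 r"
  shows "Sig (\<lambda>x. \<exists>w. pre w n = c \<and> closed_code r x w)"
  unfolding closed_code_def
  by (intro Sig_ex_baire Sig_conj Sig_all_nat Sig_dec cf_intros cf_rec2[OF assms])

text \<open>The \<open>P i\<close> need not be Sigma11 uniformly in \<open>i\<close>, so
  \<open>Sig_all_nat\<close> does not apply.\<close>

lemma Sig_bounded_all:
  assumes "\<And>i. i \<le> n \<Longrightarrow> Sig (P i)" shows "Sig (\<lambda>x. \<forall>i\<le>(n::nat). P i x)"
  using assms
proof (induction n)
  case (Suc n)
  have "Sig (\<lambda>x. (\<forall>i\<le>n. P i x) \<and> P (Suc n) x)" using Suc by (intro Sig_conj) auto
  then show ?case by (rule Sig_cong) (auto simp: le_Suc_eq)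
qed simp

text \<open>The proof approximates a point \<open>x\<close> together with witnesses \<open>z i\<close> for its membership in the
  chosen Sigma11 sets \<open>R i\<close>.\<close>

lemma generic_point:
  assumes P: "cond P" and dense: "\<And>n::nat. dense_below P (D n)"
  shows "\<exists>x\<in>P. \<forall>n. \<exists>R\<in>D n. x \<in> R"
proof -
  define inv where "inv n s \<longleftrightarrow> (case s of (R, x, z) \<Rightarrow> R 0 = P \<and>
      (\<forall>i\<le>n. cond (R i) \<and> closed_code (code (R i)) x (z i)))"
    for n :: nat and s :: "(nat \<Rightarrow> baire set) \<times> baire \<times> (nat \<Rightarrow> baire)"
  define nxt where "nxt n s s' \<longleftrightarrow> (case (s, s') of ((R, x, z), (R', x', z')) \<Rightarrow>
      pre x' n = pre x n \<and> (\<forall>i\<le>n. R' i = R i \<and> pre (z' i) n = pre (z i) n) \<and> R' (Suc n) \<in> D n)"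
    for n :: nat and s s' :: "(nat \<Rightarrow> baire set) \<times> baire \<times> (nat \<Rightarrow> baire)"
  have "\<exists>s. \<forall>n. inv n (s n) \<and> nxt n (s n) (s (Suc n))"
  proof (rule dependent_nat_choice)
    obtain x where "x \<in> P" using P unfolding cond_def by blast
    then obtain z where "closed_code (code P) x z" using code(2)[OF P] by blast
    then have "inv 0 (\<lambda>_. P, x, \<lambda>_. z)" unfolding inv_def using P by simp
    then show "\<exists>s. inv 0 s" by blast
  next
    fix s n assume "inv n s"
    then obtain R x z where s: "s = (R, x, z)" and R: "R 0 = P" "\<And>i. i \<le> n \<Longrightarrow> cond (R i)"
      "\<And>i. i \<le> n \<Longrightarrow> closed_code (code (R i)) x (z i)"
      unfolding inv_def by (cases s) auto
    \<comment> \<open>The points compatible with the first \<open>n\<close> entries of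
      \<open>x\<close> and of all witnesses chosen so far. This is a condition, as it contains
      \<open>x\<close>, so the next dense family can be met inside it without disturbing these
      entries.\<close>
    define Q where "Q = {y. pre y n = pre x n \<and>
      (\<forall>i\<le>n. \<exists>w. pre w n = pre (z i) n \<and> closed_code (code (R i)) y w)}"
    have "x \<in> Q" unfolding Q_def using R(3) by blast
    moreover have "Sig (\<lambda>y. y \<in> Q)"
      unfolding Q_def mem_Collect_eq
      by (intro Sig_conj Sig_bounded_all Sig_localized code(1) R(2) Sig_dec cf_intros)
    ultimately have "cond Q" unfolding cond_def by blast
    moreover have "Q \<subseteq> P"
    proof
      fix y assume "y \<in> Q"
      then have "\<exists>w. closed_code (code (R 0)) y w" unfolding Q_def by blast
      then show "y \<in> P" unfolding R(1) using code(2)[OF P] by blast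
    qed
    ultimately obtain S where S: "S \<in> D n" "cond S" "S \<subseteq> Q" using dense_belowD[OF dense] by blast
    then obtain x' where x': "x' \<in> S" unfolding cond_def by blast
    then obtain u where u: "closed_code (code S) x' u" using code(2)[OF S(2)] by blast
    have "\<forall>i\<le>n. \<exists>w. pre w n = pre (z i) n \<and> closed_code (code (R i)) x' w" and pre: "pre x' n = pre x n"
      using x' S(3) unfolding Q_def by blast+
    then obtain w where w: "\<forall>i\<le>n. pre (w i) n = pre (z i) n \<and> closed_code (code (R i)) x' (w i)"
      by metis
    let ?s = "(R(Suc n := S), x', w(Suc n := u))"
    have "inv (Suc n) ?s" unfolding inv_def using R(1,2) S(2) u w by (auto simp: le_Suc_eq)
    moreover have "nxt n s ?s" unfolding nxt_def s using pre w S(1) by simp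
    ultimately show "\<exists>s'. inv (Suc n) s' \<and> nxt n s s'" by blast
  qed
  then obtain s where s: "\<And>n. inv n (s n)" "\<And>n. nxt n (s n) (s (Suc n))" by blast
  define R x z where "R n = fst (s n)" and "x n = fst (snd (s n))" and "z n = snd (snd (s n))" for n
  have s_eq: "s n = (R n, x n, z n)" for n unfolding R_def x_def z_def by simp
  have inv: "R n 0 = P" "i \<le> n \<Longrightarrow> cond (R n i)" "i \<le> n \<Longrightarrow> closed_code (code (R n i)) (x n) (z n i)" for n i
    using s(1)[of n] unfolding inv_def s_eq by simp_all
  have nxt: "pre (x (Suc n)) n = pre (x n) n" "i \<le> n \<Longrightarrow> R (Suc n) i = R n i"
    "i \<le> n \<Longrightarrow> pre (z (Suc n) i) n = pre (z n i) n" "R (Suc n) (Suc n) \<in> D n" for n i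
    using s(2)[of n] unfolding nxt_def s_eq by simp_all
  obtain X where X: "\<And>n. pre X n = pre (x n) n"
    using pre_limit[of 0 x, OF nxt(1)] by blast
  have RR: "R (i + d) i = R i i" for i d
    by (induction d) (simp_all add: nxt(2))
  have mem: "X \<in> R i i" for i
  proof -
    obtain Z where Z: "\<And>n. i \<le> n \<Longrightarrow> pre Z n = pre (z n i) n"
      using pre_limit[of i "\<lambda>n. z n i", OF nxt(3)] by blast
    \<comment> \<open>At length \<open>m\<close> the limits agree with stage \<open>i + m\<close>,
      where the equation holds; membership in the closed set passes to the limit.\<close>
    have "code (R i i) (pre X m) (pre Z m) = 0" for m
    proof -
      have "R (i + m) i = R i i" by (rule RR)
      then have "closed_code (code (R i i)) (x (i + m)) (z (i + m) i)" using inv(3)[of i "i + m"] by simp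
      then have "code (R i i) (pre (x (i + m)) m) (pre (z (i + m) i) m) = 0"
        unfolding closed_code_def by blast
      moreover have "pre X m = pre (x (i + m)) m" using X[of "i + m"] unfolding pre_eq_iff by simp
      moreover have "pre Z m = pre (z (i + m) i) m" using Z[of "i + m"] unfolding pre_eq_iff by simp
      ultimately show ?thesis by simp
    qed
    then have "closed_code (code (R i i)) X Z" unfolding closed_code_def by blast
    then show ?thesis using code(2)[OF inv(2)[of i i]] by blast
  qed
  show ?thesis
  proof (intro bexI[of _ X] allI)
    show "X \<in> P" using mem[of 0] inv(1) by simp
    show "\<exists>S\<in>D n. X \<in> S" for n using mem[of "Suc n"] nxt(4)[of n] by blast
  qed
qed

lemma forces_nonempty:
  assumes "cond P" "forces P A" shows "P \<inter> A \<noteq> {}"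
proof -
  obtain D where D: "\<And>n::nat. dense_below P (D n)" "\<forall>x\<in>P. (\<forall>n. \<exists>R\<in>D n. x \<in> R) \<longrightarrow> x \<in> A"
    by (rule forcesE[OF assms(2)]) (rule that)
  obtain x where "x \<in> P" "\<forall>n. \<exists>R\<in>D n. x \<in> R" using generic_point[of P D, OF assms(1) D(1)] by blast
  with D(2) show ?thesis by blast
qed

subsection \<open>Borel sets\<close>

lemma baire_open_box:
  fixes A :: "baire set"
  assumes "open A" "x \<in> A" obtains n where "{y. pre y n = pre x n} \<subseteq> A"
proof -
  have "openin (product_topology (\<lambda>i. euclidean) UNIV) A" using assms(1) unfolding open_fun_def .
  from product_topology_open_contains_basis[OF this assms(2)] obtain X where
    X: "x \<in> (\<Pi>\<^sub>E i\<in>UNIV. X i)" "finite {i. X i \<noteq> UNIV}" "(\<Pi>\<^sub>E i\<in>UNIV. X i) \<subseteq> A"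
    by auto
  obtain n where n: "\<And>i. X i \<noteq> UNIV \<Longrightarrow> i < n"
    using finite_nat_set_iff_bounded[THEN iffD1, OF X(2)] by blast
  have "{y. pre y n = pre x n} \<subseteq> (\<Pi>\<^sub>E i\<in>UNIV. X i)"
  proof
    fix y assume "y \<in> {y. pre y n = pre x n}"
    then have y: "y i = x i" if "i < n" for i using that by (simp add: pre_eq_iff)
    have "y i \<in> X i" for i
    proof (cases "X i = UNIV")
      case False
      then have "y i = x i" using n y by blast
      moreover have "x i \<in> X i" using X(1) by (simp add: PiE_iff)
      ultimately show ?thesis by simp
    qed simp
    then show "y \<in> (\<Pi>\<^sub>E i\<in>UNIV. X i)" by (simp add: PiE_iff)
  qed
  with X(3) show thesis by (intro that[of n]) blast
qed

text \<open>Below \<open>P\<close> each \<open>A n\<close> can be decided but never positively, so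
  the conditions that force its complement are dense.\<close>

lemma forces_UNION_neg:
  assumes P: "cond P" and dec: "\<And>n Q. cond Q \<Longrightarrow> \<exists>R\<subseteq>Q. cond R \<and> (forces R (A n) \<or> forces R (- A n))"
    and no: "\<And>n Q. cond Q \<Longrightarrow> Q \<subseteq> P \<Longrightarrow> \<not> forces Q (A n)"
  shows "forces P (- (\<Union>n::nat. A n))"
proof -
  have "forces P (- A n)" for n
  proof (rule forces_locally[OF P])
    show "dense_below P {R. forces R (- A n)}"
      unfolding dense_below_def
    proof (intro allI impI)
      fix Q assume Q: "cond Q" "Q \<subseteq> P"
      obtain R where R: "R \<subseteq> Q" "cond R" "forces R (A n) \<or> forces R (- A n)" using dec[OF Q(1)] by blast
      moreover have "\<not> forces R (A n)" using no[of R] R Q(2) by blast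
      ultimately show "\<exists>R\<in>{R. forces R (- A n)}. cond R \<and> R \<subseteq> Q" by blast
    qed
  qed
  then have "forces P (\<Inter>n. - A n)" by (rule forces_INT)
  then show ?thesis by simp
qed

text \<open>The property of Baire, by induction on the generation of Borel sets. The claim is
  symmetric in \<open>A\<close> and its complement and is proved for all conditions at once, as the
  step for unions uses it below \<open>P\<close>.\<close>

lemma borel_decided:
  fixes A :: "baire set"
  assumes "A \<in> sets borel" "cond P"
  shows "\<exists>Q\<subseteq>P. cond Q \<and> (forces Q A \<or> forces Q (- A))"
proof -
  have "A \<in> sigma_sets UNIV {S. open S}" using assms(1) by (simp add: borel_def)
  then have "\<forall>P. cond P \<longrightarrow> (\<exists>Q\<subseteq>P. cond Q \<and> (forces Q A \<or> forces Q (- A)))"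
  proof (induction rule: sigma_sets.induct)
    case (Basic A)
    show ?case
    proof (intro allI impI)
      fix P assume P: "cond P"
      show "\<exists>Q\<subseteq>P. cond Q \<and> (forces Q A \<or> forces Q (- A))"
      proof (cases "P \<inter> A = {}")
        case True
        then have "forces P (- A)" by (intro forces_subset) blast
        with P show ?thesis by blast
      next
        case False
        then obtain x where x: "x \<in> P" "x \<in> A" by blast
        from Basic have "open A" by simp
        then obtain n where n: "{y. pre y n = pre x n} \<subseteq> A" using x(2) by (rule baire_open_box)
        let ?B = "{y. pre y n = pre x n}"
        have "Sig (\<lambda>y. y \<in> ?B)" unfolding mem_Collect_eq by (intro Sig_dec cf_intros)
        then have "cond ?B" unfolding cond_def by blast
        then have "cond (P \<inter> ?B)" using P x(1) by (intro cond_Int) auto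
        moreover have "forces (P \<inter> ?B) A" using n by (intro forces_subset) blast
        ultimately show ?thesis by blast
      qed
    qed
  next
    case Empty
    show ?case using forces_subset[of _ "- {}"] by blast
  next
    case (Compl A)
    then show ?case unfolding Compl_eq_Diff_UNIV[symmetric] double_complement by blast
  next
    case (Union A)
    show ?case
    proof (intro allI impI)
      fix P assume P: "cond P"
      show "\<exists>Q\<subseteq>P. cond Q \<and> (forces Q (\<Union>n. A n) \<or> forces Q (- (\<Union>n. A n)))"
      proof (cases "\<exists>n Q. cond Q \<and> Q \<subseteq> P \<and> forces Q (A n)")
        case True
        then obtain n Q where Q: "cond Q" "Q \<subseteq> P" "forces Q (A n)" by blast
        obtain D where D: "\<And>n::nat. dense_below Q (D n)" "\<forall>x\<in>Q. (\<forall>n. \<exists>R\<in>D n. x \<in> R) \<longrightarrow> x \<in> A n"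
          by (rule forcesE[OF Q(3)]) (rule that)
        have "forces Q (\<Union>n. A n)" 
        proof (rule forcesI[of Q D])
          fix x assume "x \<in> Q" "\<And>n. \<exists>R\<in>D n. x \<in> R"
          then have "x \<in> A n" using D(2) by simp
          then show "x \<in> (\<Union>n. A n)" by blast
        qed (rule D(1))
        with Q show ?thesis by blast
      next
        case False
        have "forces P (- (\<Union>n. A n))"
        proof (rule forces_UNION_neg[OF P])
          show "\<exists>R\<subseteq>Q. cond R \<and> (forces R (A n) \<or> forces R (- A n))" if "cond Q" for n Q
            using Union.IH[of n] that by blast
        qed (use False in blast)
        with P show ?thesis by blast
      qed
    qed
  qed
  with assms(2) show ?thesis by blast
qed

text \<open>Otherwise \<open>P\<close> would force the complement of the whole cover, and a generic
  point of \<open>P\<close> would escape it.\<close>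

lemma countable_cover_forces:
  assumes "cond P" "P \<subseteq> \<Union>\<A>" "countable \<A>" "\<A> \<subseteq> sets borel"
  shows "\<exists>A\<in>\<A>. \<exists>Q\<subseteq>P. cond Q \<and> forces Q A"
proof (rule ccontr)
  assume no: "\<not> (\<exists>A\<in>\<A>. \<exists>Q\<subseteq>P. cond Q \<and> forces Q A)"
  have "\<A> \<noteq> {}" using assms(1,2) unfolding cond_def by blast
  then have A: "range (from_nat_into \<A>) = \<A>" using assms(3) by (rule range_from_nat_into)
  have "forces P (- (\<Union>n. from_nat_into \<A> n))"
  proof (rule forces_UNION_neg[OF assms(1)])
    show "\<exists>R\<subseteq>Q. cond R \<and> (forces R (from_nat_into \<A> n) \<or> forces R (- from_nat_into \<A> n))"
      if "cond Q" for n Q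
      by (rule borel_decided[OF _ that]) (use A assms(4) in blast)
    show "\<not> forces Q (from_nat_into \<A> n)" if "cond Q" "Q \<subseteq> P" for n Q
      using no that A by blast
  qed
  from forces_nonempty[OF assms(1) this] show False using assms(2) unfolding A by blast
qed

section \<open>Genericity under computable maps\<close>

lemma Sig_image:
  fixes h :: "baire \<Rightarrow> baire"
  assumes h: "cf h" and S: "Sig (\<lambda>x. x \<in> S)" shows "Sig (\<lambda>v. v \<in> h ` S)"
proof -
  have "cf (\<lambda>q::(baire \<times> baire) \<times> nat. h (snd (fst q)) (snd q))"
    by (rule cf_app[OF cf_comp[OF h]]) (intro cf_intros)+
  then have "Sig (\<lambda>q::(baire \<times> baire) \<times> nat. h (snd (fst q)) (snd q) = fst (fst q) (snd q))"
    by (intro Sig_dec dec_eq cf_intros)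
  then have "Sig (\<lambda>p::baire \<times> baire. \<forall>i. h (snd p) i = fst p i)" by (rule Sig_all_nat)
  moreover have "Sig (\<lambda>p::baire \<times> baire. snd p \<in> S)" by (rule Sig_comp[OF S]) (intro cf_intros)
  ultimately have "Sig (\<lambda>v. \<exists>u. u \<in> S \<and> (\<forall>i. h u i = v i))"
    by (intro Sig_ex_baire[of "\<lambda>v u. u \<in> S \<and> (\<forall>i. h u i = v i)"] Sig_conj)
  moreover have "(\<exists>u. u \<in> S \<and> (\<forall>i. h u i = v i)) \<longleftrightarrow> v \<in> h ` S" for v
    unfolding image_iff fun_eq_iff by metis
  ultimately show ?thesis by (rule Sig_cong)
qed

text \<open>A computable map sends generic points to generic points: the image of a condition
  \<open>S\<close> is a condition, a member \<open>T\<close> of the dense family is found inside it,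
  and the part of \<open>S\<close> over \<open>T\<close> is nonempty.\<close>

lemma forces_vimage:
  assumes h: "cf h" and R: "h ` R \<subseteq> Q" and "forces Q A" shows "forces R (h -` A)"
proof -
  obtain D where D: "\<And>n::nat. dense_below Q (D n)" "\<forall>x\<in>Q. (\<forall>n. \<exists>R\<in>D n. x \<in> R) \<longrightarrow> x \<in> A"
    by (rule forcesE[OF assms(3)]) (rule that)
  show ?thesis
  proof (rule forcesI[of R "\<lambda>n. {S. \<exists>T\<in>D n. h ` S \<subseteq> T}"])
    fix n
    show "dense_below R {S. \<exists>T\<in>D n. h ` S \<subseteq> T}"
      unfolding dense_below_def
    proof (intro allI impI)
      fix S assume S: "cond S" "S \<subseteq> R"
      have SS: "Sig (\<lambda>x. x \<in> S)" using S(1) unfolding cond_def by (rule conjunct2)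
      have "h ` S \<noteq> {}" using S(1) unfolding cond_def by simp
      with Sig_image[OF h SS] have "cond (h ` S)" unfolding cond_def by (rule conjI[rotated])
      moreover have "h ` S \<subseteq> Q" using S(2) R by blast
      ultimately obtain T where T: "T \<in> D n" "cond T" "T \<subseteq> h ` S" using dense_belowD[OF D(1)] by blast
      have "Sig (\<lambda>u. u \<in> S \<inter> h -` T)"
        unfolding Int_iff vimage_eq
        by (intro Sig_conj SS Sig_comp[OF conjunct2[OF T(2)[unfolded cond_def]] h])
      moreover have "S \<inter> h -` T \<noteq> {}" using T(2,3) unfolding cond_def by blast
      ultimately have "cond (S \<inter> h -` T)" unfolding cond_def by blast
      then show "\<exists>U\<in>{S. \<exists>T\<in>D n. h ` S \<subseteq> T}. cond U \<and> U \<subseteq> S" using T(1) by blast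
    qed
  next
    fix x assume x: "x \<in> R" "\<And>n. \<exists>S\<in>{S. \<exists>T\<in>D n. h ` S \<subseteq> T}. x \<in> S"
    have "\<exists>T\<in>D n. h x \<in> T" for n using x(2)[of n] by blast
    moreover have "h x \<in> Q" using x(1) R by blast
    ultimately have "h x \<in> A" using D(2) by blast
    then show "x \<in> h -` A" by simp
  qed
qed

lemma forces_graph_functional:
  assumes Q: "cond Q" and f: "forces Q {w. od w = f (ev w)}" shows "functional Q"
proof (rule ccontr)
  assume "\<not> functional Q"
  then obtain w w' where w: "w \<in> Q" "w' \<in> Q" "ev w = ev w'" "od w \<noteq> od w'"
    unfolding functional_def by blast
  \<comment> \<open>The triples, coded as pairs of pairs. Equality and inequality of points are
    stated entry by entry, since only entries can be compared computably.\<close>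
  define R where "R = {u. ev u \<in> Q \<and> od u \<in> Q \<and> (\<forall>i. ev (ev u) i = ev (od u) i) \<and>
    (\<exists>i. od (ev u) i \<noteq> od (od u) i)}"
  have SQ: "Sig (\<lambda>x. x \<in> Q)" using Q unfolding cond_def by blast
  have "Sig (\<lambda>u. u \<in> R)"
    unfolding R_def mem_Collect_eq
    by (intro Sig_conj Sig_ex_nat Sig_all_nat Sig_comp[OF SQ] Sig_dec cf_app[OF cf_ev]
        cf_app[OF cf_od] cf_intros)
  moreover have "enc (w, w') \<in> R"
    unfolding R_def using w by (simp add: fun_eq_iff)
  ultimately have R: "cond R" unfolding cond_def by blast
  have "forces R (ev -` {w. od w = f (ev w)})"
    by (rule forces_vimage[OF cf_ev[OF cf_id] _ f]) (auto simp: R_def)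
  moreover have "forces R (od -` {w. od w = f (ev w)})"
    by (rule forces_vimage[OF cf_od[OF cf_id] _ f]) (auto simp: R_def)
  ultimately have "R \<inter> (ev -` {w. od w = f (ev w)} \<inter> od -` {w. od w = f (ev w)}) \<noteq> {}"
    by (intro forces_nonempty[OF R] forces_Int)
  then obtain u where u: "u \<in> R" "od (ev u) = f (ev (ev u))" "od (od u) = f (ev (od u))" by blast
  have "ev (ev u) = ev (od u)" using u(1) unfolding R_def by (simp add: fun_eq_iff)
  with u show False unfolding R_def by simp
qed

lemma continuous_ev: "continuous_on UNIV ev" and continuous_od: "continuous_on UNIV od"
  unfolding ev_def[abs_def] od_def[abs_def]
  by (intro continuous_on_coordinatewise_then_product continuous_on_product_coordinates)+

lemma borel_graph:
  fixes f g :: "baire \<Rightarrow> baire"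
  assumes "f \<in> borel_measurable borel" "g \<in> borel_measurable borel"
  shows "{w. f w = g w} \<in> sets borel"
proof -
  have c: "(\<lambda>w. h w i) \<in> borel_measurable borel" if "h \<in> borel_measurable borel" for h :: "baire \<Rightarrow> baire" and i
    using measurable_compose[OF that borel_measurable_continuous_onI[OF continuous_on_product_coordinates[of i]]]
    by simp
  have v: "(\<lambda>w. h w i) -` {k} \<in> sets borel" if "h \<in> borel_measurable borel" for h :: "baire \<Rightarrow> baire" and i k
    using measurable_sets[OF c[OF that, of i], of "{k}"] by simp
  have "(\<lambda>w. f w i) -` {k} \<inter> (\<lambda>w. g w i) -` {k} \<in> sets borel" for i k
    by (rule sets.Int[OF v[OF assms(1)] v[OF assms(2)]])
  then have "(\<Union>k. (\<lambda>w. f w i) -` {k} \<inter> (\<lambda>w. g w i) -` {k}) \<in> sets borel" for i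
    by (intro sets.countable_UN) blast
  then have "(\<Inter>i. \<Union>k. (\<lambda>w. f w i) -` {k} \<inter> (\<lambda>w. g w i) -` {k}) \<in> sets borel"
    by (intro sets.countable_INT) auto
  moreover have "{w. f w = g w} = (\<Inter>i. \<Union>k. (\<lambda>w. f w i) -` {k} \<inter> (\<lambda>w. g w i) -` {k})"
    by (auto simp: fun_eq_iff)
  ultimately show ?thesis by simp
qed

section \<open>Emptiness of the uncovered part of the graph\<close>

theorem theorem4p3:
  fixes G :: "(baire \<times> baire) set"
    and I :: "'i set"
    and f :: "'i \<Rightarrow> baire \<Rightarrow> baire"
  assumes "is_graph G"
    and "delta11_rel G"
    and "countable I"
    and "\<forall>i\<in>I. f i \<in> borel_measurable borel"
    and "generated_by G I f"
  shows "\<exists>(J :: nat set) (g :: nat \<Rightarrow> baire \<Rightarrow> baire).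
           countable J \<and> (\<forall>j\<in>J. delta11_fun (g j)) \<and> generated_by G J g"
proof (rule function_cover)
  fix J :: "nat set" and g :: "nat \<Rightarrow> baire \<Rightarrow> baire" and V :: "baire \<times> baire \<Rightarrow> bool"
  assume J: "\<And>j. j \<in> J \<Longrightarrow> delta11_fun (g j)" "Sig V"
      "\<And>x y. \<not> V (x, y) \<Longrightarrow> \<exists>j\<in>J. y = g j x"
      "\<And>Q w. Sig (\<lambda>w. w \<in> Q) \<Longrightarrow> functional Q \<Longrightarrow> w \<in> Q \<Longrightarrow> \<not> V (ev w, od w)"
  define H where "H = {w. (ev w, od w) \<in> G \<and> V (ev w, od w) \<and> V (od w, ev w)}"
  have SG: "Sig (\<lambda>p. p \<in> G)" using assms(2) unfolding delta11_iff_Del Del_def by blast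
  have SH: "Sig (\<lambda>w. w \<in> H)"
    unfolding H_def mem_Collect_eq by (intro Sig_conj Sig_comp[OF SG] Sig_comp[OF J(2)] cf_intros)
  have "H = {}"
  proof (rule ccontr)
    assume "H \<noteq> {}"
    with SH have H: "cond H" unfolding cond_def by blast
    define \<A> where "\<A> = (\<lambda>i. {w. od w = f i (ev w)}) ` I \<union> (\<lambda>i. {w. ev w = f i (od w)}) ` I"
    have m: "ev \<in> borel_measurable borel" "od \<in> borel_measurable borel"
      by (intro borel_measurable_continuous_onI continuous_ev continuous_od)+
    have "countable \<A>" unfolding \<A>_def using assms(3) by blast
    moreover have "\<A> \<subseteq> sets borel"
    proof -
      have "{w. od w = f i (ev w)} \<in> sets borel" "{w. ev w = f i (od w)} \<in> sets borel" if "i \<in> I" for i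
        using borel_graph[OF m(2) measurable_compose[OF m(1) assms(4)[rule_format, OF that]]]
          borel_graph[OF m(1) measurable_compose[OF m(2) assms(4)[rule_format, OF that]]] .
      then show ?thesis unfolding \<A>_def by blast
    qed
    moreover have "H \<subseteq> \<Union>\<A>"
    proof
      fix w assume "w \<in> H"
      then have "(ev w, od w) \<in> G" unfolding H_def by simp
      with assms(5) have "(ev w, od w) \<in> {(x, y). \<exists>i\<in>I. y = f i x \<or> x = f i y}"
        unfolding generated_by_def by (rule subsetD)
      then show "w \<in> \<Union>\<A>" unfolding \<A>_def by auto
    qed
    ultimately obtain A Q where A: "A \<in> \<A>" and Q: "Q \<subseteq> H" "cond Q" "forces Q A"
      using countable_cover_forces[OF H] by blast
    have SQ: "Sig (\<lambda>w. w \<in> Q)" using Q(2) unfolding cond_def by blast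
    obtain w where w: "w \<in> Q" using Q(2) unfolding cond_def by blast
    \<comment> \<open>Swapping coordinates turns the inverse of a graph into a graph. As
      \<open>H\<close> demands \<open>V\<close> in both orders, the swapped set leads to the same
      contradiction.\<close>
    define swap where "swap w = enc (od w, ev w)" for w :: baire
    have swap: "ev (swap w) = od w" "od (swap w) = ev w" for w by (simp_all add: swap_def)
    have swap2: "swap (swap w) = w" for w
      by (rule ext) (auto simp: swap_def enc_prod ev_def od_def)
    have cswap: "cf swap" unfolding swap_def[abs_def] by (intro cf_intros)
    from A consider i where "A = {w. od w = f i (ev w)}" | i where "A = {w. ev w = f i (od w)}"
      unfolding \<A>_def by blast
    then show False
    proof cases
      case 1
      with Q(3) have "forces Q {w. od w = f i (ev w)}" by simp
      then have "functional Q" by (rule forces_graph_functional[OF Q(2)])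
      from J(4)[OF SQ this w] show False using w Q(1) unfolding H_def by blast
    next
      case 2
      have "swap -` A = {w. od w = f i (ev w)}" unfolding 2 by (simp add: swap)
      moreover have "forces (swap -` Q) (swap -` A)" by (rule forces_vimage[OF cswap _ Q(3)]) blast
      ultimately have F: "forces (swap -` Q) {w. od w = f i (ev w)}" by simp
      have S: "Sig (\<lambda>w. w \<in> swap -` Q)" unfolding vimage_eq by (rule Sig_comp[OF SQ cswap])
      have sw: "swap w \<in> swap -` Q" using w by (simp add: swap2)
      from S sw have "cond (swap -` Q)" unfolding cond_def by blast
      then have "functional (swap -` Q)" using F by (rule forces_graph_functional)
      from J(4)[OF S this sw] show False using w Q(1) unfolding H_def swap by blast
    qed
  qed
  have "generated_by G J g"
    unfolding generated_by_def
  proof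
    fix p assume p: "p \<in> G"
    obtain x y where xy: "p = (x, y)" by (cases p)
    have "enc (x, y) \<notin> H" using \<open>H = {}\<close> by blast
    then have "\<not> V (x, y) \<or> \<not> V (y, x)" using p unfolding H_def xy by simp
    then show "p \<in> {(x, y). \<exists>i\<in>J. y = g i x \<or> x = g i y}" using J(3) unfolding xy by blast
  qed
  moreover have "countable J" by (rule countableI_type)
  ultimately show ?thesis using J(1) by blast
qed

end
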